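(* Let $N\ge2$, let $\omega\subset\mathbb R^{N-1}$ be a smooth bounded domain and let $\mathcal C_\omega=\omega\times(0,+\infty)\subset\mathbb R^N$ be the cylinder spanned by $\omega$. Let $\varphi\in C^2(\overline\omega)$ be a positive function, let $\Gamma_\varphi=\{(x',\varphi(x')):x'\in\omega\}$ and $\Omega_\varphi=\{(x',x_N):\ x'\in\omega,\ 0<x_N<\varphi(x')\}\subset\mathcal C_\omega$, and assume that $\Gamma_\varphi$ meets $\partial\mathcal C_\omega$ orthogonally. If $\Omega_\varphi$ is self-Cheeger relative to $\mathcal C_\omega$, then $$H_{\Gamma_\varphi}\le\frac{P_{\mathcal C_\omega}(\Omega_\varphi)}{(N-1)|\Omega_\varphi|}$$ at every point of $\Gamma_\varphi$.
   Context: The exterior unit normal to $\Gamma_\varphi$ at $(x',\varphi(x'))$, $x'\in\overline\omega$, is $\nu_{\Gamma_\varphi}=\frac{1}{\sqrt{1+|\nabla\varphi|^2}}(-\nabla\varphi,1)$. The mean curvature of $\Gamma_\varphi$ with respect to it is $$H_{\Gamma_\varphi}=-\frac1{N-1}\operatorname{div}\Big(\frac{\nabla\varphi}{\sqrt{1+|\nabla\varphi|^2}}\Big).$$ "$\Gamma_\varphi$ meets $\partial\mathcal C_\omega$ orthogonally" means that $\nu_{\Gamma_\varphi}(x)\cdot(\nu_{\partial\omega}(x'),0)=0$ for all $x=(x',x_N)\in\overline{\Gamma_\varphi}\cap\partial\mathcal C_\omega$, where $\nu_{\partial\omega}$ is the unit outward normal to $\partial\omega$. For an unbounded Lipschitz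 domain $\mathcal C\subset\mathbb R^N$ and a set $E\subset\mathcal C$, the relative perimeter is $P_{\mathcal C}(E)=\sup\{\int_E\operatorname{div}\psi\,dx:\psi\in C_c^1(\mathcal C,\mathbb R^N),\|\psi\|_\infty\le1\}$, which equals the $(N-1)$-dimensional Hausdorff measure of $\partial E\cap\mathcal C$ if $\partial E\cap\mathcal C$ is Lipschitz. $|E|$ is the Lebesgue measure. The relative Cheeger constant of $\Omega\subseteq\mathcal C$ is $h_{\mathcal C}(\Omega)=\inf_{E\subseteq\Omega}P_{\mathcal C}(E)/|E|$ (over measurable $E\subseteq\Omega$ with $|E|>0$). $\Omega$ is self-Cheeger relative to $\mathcal C$ if $P_{\mathcal C}(\Omega)/|\Omega|=h_{\mathcal C}(\Omega)$. *)

theory Defs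
  imports "HOL-Analysis.Analysis"
begin

(* R^(N-1) is a Euclidean space 'a with DIM('a) = N - 1, and R^N is 'a \<times> real;
   every Euclidean space has positive dimension, so N \<ge> 2. *)

section \<open>Differential operators and spaces of differentiable functions\<close>

definition grad :: "('a::euclidean_space \<Rightarrow> real) \<Rightarrow> 'a \<Rightarrow> 'a" where
  "grad f x = (\<Sum>b\<in>Basis. frechet_derivative f (at x) b *\<^sub>R b)"

definition divergence :: "('a::euclidean_space \<Rightarrow> 'a) \<Rightarrow> 'a \<Rightarrow> real" where
  "divergence F x = (\<Sum>b\<in>Basis. frechet_derivative F (at x) b \<bullet> b)"

lemma GDERIV_grad:
  fixes f :: "'a::euclidean_space \<Rightarrow> real"
  assumes "f differentiable at x"
  shows "GDERIV f x :> grad f x"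
proof -
  have D: "(f has_derivative frechet_derivative f (at x)) (at x)"
    using assms by (simp add: frechet_derivative_works)
  then interpret bounded_linear "frechet_derivative f (at x)"
    by (rule has_derivative_bounded_linear)
  have "frechet_derivative f (at x) h = h \<bullet> grad f x" for h
  proof -
    have "frechet_derivative f (at x) h
        = frechet_derivative f (at x) (\<Sum>b\<in>Basis. (h \<bullet> b) *\<^sub>R b)"
      by (simp add: euclidean_representation)
    also have "\<dots> = h \<bullet> grad f x"
      by (simp add: grad_def sum scaleR inner_sum_right mult.commute)
    finally show ?thesis .
  qed
  then have "frechet_derivative f (at x) = (\<lambda>h. h \<bullet> grad f x)" by blast
  with D show ?thesis by (simp add: gderiv_def)
qed

(* C^k(U), for open U *)
primrec Ck_on :: "nat \<Rightarrow> ('a::euclidean_space \<Rightarrow> 'b::real_normed_vector) \<Rightarrow> 'a set \<Rightarrow> bool" where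
  "Ck_on 0 f U \<longleftrightarrow> continuous_on U f"
| "Ck_on (Suc k) f U \<longleftrightarrow> (\<forall>x\<in>U. f differentiable (at x)) \<and>
     (\<forall>b\<in>Basis. Ck_on k (\<lambda>x. frechet_derivative f (at x) b) U)"

(* C^k of the closure of U, for open U: the partial derivatives of order at most k exist
   in U and extend continuously to the closure of U. *)
primrec Ck_closure :: "nat \<Rightarrow> ('a::euclidean_space \<Rightarrow> real) \<Rightarrow> 'a set \<Rightarrow> bool" where
  "Ck_closure 0 f U \<longleftrightarrow> continuous_on (closure U) f"
| "Ck_closure (Suc k) f U \<longleftrightarrow> continuous_on (closure U) f \<and>
     (\<forall>x\<in>U. f differentiable (at x)) \<and>
     (\<forall>b\<in>Basis. \<exists>g. Ck_closure k g U \<and> (\<forall>x\<in>U. g x = frechet_derivative f (at x) b))"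

(* The continuous extension of the gradient to the closure of U; it coincides with
   grad f in U when f is C^1 there. *)
definition grad_closure :: "'a::euclidean_space set \<Rightarrow> ('a \<Rightarrow> real) \<Rightarrow> 'a \<Rightarrow> 'a" where
  "grad_closure U f x = Lim (at x within U) (grad f)"


section \<open>Smooth bounded domains and their outward normal\<close>

definition local_defining_function ::
  "'a::euclidean_space set \<Rightarrow> 'a \<Rightarrow> 'a set \<Rightarrow> ('a \<Rightarrow> real) \<Rightarrow> bool" where
  "local_defining_function \<omega> p U \<rho> \<longleftrightarrow>
     open U \<and> p \<in> U \<and> (\<forall>k. Ck_on k \<rho> U) \<and> (\<forall>x\<in>U. grad \<rho> x \<noteq> 0) \<and>
     \<omega> \<inter> U = {x\<in>U. \<rho> x < 0} \<and> frontier \<omega> \<inter> U = {x\<in>U. \<rho> x = 0}"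

definition smooth_bounded_domain :: "'a::euclidean_space set \<Rightarrow> bool" where
  "smooth_bounded_domain \<omega> \<longleftrightarrow>
     open \<omega> \<and> connected \<omega> \<and> \<omega> \<noteq> {} \<and> bounded \<omega> \<and>
     (\<forall>p\<in>frontier \<omega>. \<exists>U \<rho>. local_defining_function \<omega> p U \<rho>)"

(* The normal does not depend on the choice of the local defining function. *)
definition outward_unit_normal :: "'a::euclidean_space set \<Rightarrow> 'a \<Rightarrow> 'a \<Rightarrow> bool" where
  "outward_unit_normal \<omega> p \<nu> \<longleftrightarrow> p \<in> frontier \<omega> \<and>
     (\<exists>U \<rho>. local_defining_function \<omega> p U \<rho> \<and> \<nu> = grad \<rho> p /\<^sub>R norm (grad \<rho> p))"


section \<open>Cylinder, graph and subgraph\<close>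

definition cylinder :: "'a set \<Rightarrow> ('a \<times> real) set" where
  "cylinder \<omega> = \<omega> \<times> {0<..}"

definition graph_over :: "'a set \<Rightarrow> ('a \<Rightarrow> real) \<Rightarrow> ('a \<times> real) set" where
  "graph_over \<omega> \<phi> = {(x, \<phi> x) |x. x \<in> \<omega>}"

definition subgraph :: "'a set \<Rightarrow> ('a \<Rightarrow> real) \<Rightarrow> ('a \<times> real) set" where
  "subgraph \<omega> \<phi> = {(x, t) |x t. x \<in> \<omega> \<and> 0 < t \<and> t < \<phi> x}"

(* Exterior normal at (x, \<phi> x); on the frontier of \<omega> the gradient is the extended one. *)
definition graph_normal ::
  "'a::euclidean_space set \<Rightarrow> ('a \<Rightarrow> real) \<Rightarrow> 'a \<Rightarrow> 'a \<times> real" where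
  "graph_normal \<omega> \<phi> x =
     (1 / sqrt (1 + (norm (grad_closure \<omega> \<phi> x))\<^sup>2)) *\<^sub>R (- grad_closure \<omega> \<phi> x, 1)"

(* With respect to the exterior normal; DIM('a) = N - 1 *)
definition graph_mean_curvature :: "('a::euclidean_space \<Rightarrow> real) \<Rightarrow> 'a \<Rightarrow> real" where
  "graph_mean_curvature \<phi> x =
     - (1 / real DIM('a)) *
       divergence (\<lambda>y. (1 / sqrt (1 + (norm (grad \<phi> y))\<^sup>2)) *\<^sub>R grad \<phi> y) x"

definition meets_orthogonally :: "'a::euclidean_space set \<Rightarrow> ('a \<Rightarrow> real) \<Rightarrow> bool" where
  "meets_orthogonally \<omega> \<phi> \<longleftrightarrow>
     (\<forall>x \<in> closure (graph_over \<omega> \<phi>) \<inter> frontier (cylinder \<omega>).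
        \<forall>\<nu>. outward_unit_normal \<omega> (fst x) \<nu> \<longrightarrow> graph_normal \<omega> \<phi> (fst x) \<bullet> (\<nu>, 0) = 0)"


section \<open>Relative perimeter and relative Cheeger constant\<close>

(* C^1_c(C, R^N), for open C; fields are extended by 0 outside C. *)
definition test_fields :: "'b::euclidean_space set \<Rightarrow> ('b \<Rightarrow> 'b) set" where
  "test_fields C = {\<psi>. Ck_on 1 \<psi> UNIV \<and>
     compact (closure {x. \<psi> x \<noteq> 0}) \<and> closure {x. \<psi> x \<noteq> 0} \<subseteq> C}"

definition rel_perimeter :: "'b::euclidean_space set \<Rightarrow> 'b set \<Rightarrow> ereal" where
  "rel_perimeter C E =
     (SUP \<psi>\<in>{\<psi> \<in> test_fields C. \<forall>x. norm (\<psi> x) \<le> 1}.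
        ereal (LINT x:E|lebesgue. divergence \<psi> x))"

definition vol :: "'b::euclidean_space set \<Rightarrow> ereal" where
  "vol E = enn2ereal (emeasure lebesgue E)"

definition rel_cheeger_constant :: "'b::euclidean_space set \<Rightarrow> 'b set \<Rightarrow> ereal" where
  "rel_cheeger_constant C \<Omega> =
     (INF E\<in>{E. E \<in> sets lebesgue \<and> E \<subseteq> \<Omega> \<and> vol E > 0}. rel_perimeter C E / vol E)"

definition self_cheeger :: "'b::euclidean_space set \<Rightarrow> 'b set \<Rightarrow> bool" where
  "self_cheeger C \<Omega> \<longleftrightarrow> rel_perimeter C \<Omega> / vol \<Omega> = rel_cheeger_constant C \<Omega>"

end

theory Submission imports Defs begin

text \<open>Suppose that at a point of the graph \<open>(N - 1) H\<close> exceeds the quotient \<open>h = P / |\<Omega>|\<close>, and hence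
  exceeds some \<open>h' > h\<close> on a small ball. Push the graph down there to \<open>\<phi> - t \<eta>\<close> with a bump
  function \<open>\<eta>\<close>, which cuts a region \<open>D\<close> of volume at least \<open>q t\<close> out of \<open>\<Omega>\<close>. The upward normal \<open>Y\<close>
  of the graph, extended constantly in the vertical direction, has divergence \<open>(N - 1) H \<ge> h'\<close> on \<open>D\<close>.
  Given a test field \<open>\<psi>\<close> for the smaller set, interpolate from \<open>\<psi>\<close> to \<open>Y\<close> in a thin layer above the
  lowered graph. The divergence of the interpolated field is that of \<open>\<psi>\<close> below the layer and that of
  \<open>Y\<close> above it, and the layer contributes only \<open>O(t\<^sup>2)\<close> from below, because \<open>Y\<close> is almost the normal of
  the lowered graph. So the perimeter of the smaller set is at most \<open>P - h' |D| + O(t\<^sup>2)\<close>, and for small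
  \<open>t\<close> its quotient is below \<open>h\<close>.\<close>

section \<open>Calculus of continuously differentiable maps\<close>

lemma Ck1_iff:
  fixes F :: "'a::euclidean_space \<Rightarrow> 'b::real_normed_vector"
  shows "Ck_on 1 F V \<longleftrightarrow> (\<forall>x\<in>V. F differentiable (at x)) \<and>
    (\<forall>b\<in>Basis. continuous_on V (\<lambda>x. frechet_derivative F (at x) b))"
  by simp

text \<open>Derivatives are unique, so an explicit candidate \<open>F'\<close> may stand in for
  \<open>frechet_derivative\<close> when the class C^1 is checked.\<close>

lemma Ck1I:
  fixes F :: "'a::euclidean_space \<Rightarrow> 'b::real_normed_vector"
  assumes "\<And>x. x \<in> V \<Longrightarrow> (F has_derivative F' x) (at x)"
    and "\<And>b. b \<in> Basis \<Longrightarrow> continuous_on V (\<lambda>x. F' x b)"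
  shows "Ck_on 1 F V"
proof -
  have "frechet_derivative F (at x) = F' x" if "x \<in> V" for x
    using assms(1)[OF that] frechet_derivative_at by metis
  then show ?thesis
    unfolding Ck1_iff using assms
    by (auto simp: differentiable_def cong: continuous_on_cong)
qed

lemma Ck1_has_derivative:
  "Ck_on 1 F V \<Longrightarrow> x \<in> V \<Longrightarrow> (F has_derivative frechet_derivative F (at x)) (at x)"
  unfolding Ck1_iff by (simp add: frechet_derivative_works)

lemma Ck1_continuous_on: "Ck_on 1 F V \<Longrightarrow> continuous_on V F"
  unfolding Ck1_iff
  by (meson continuous_at_imp_continuous_on differentiable_imp_continuous_within)

text \<open>By linearity a derivative in a fixed direction is a fixed finite combination of partial
  derivatives.\<close>

lemma Ck1_continuous_partial:
  assumes "Ck_on 1 F V"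
  shows "continuous_on V (\<lambda>x. frechet_derivative F (at x) h)"
proof -
  have "frechet_derivative F (at x) h = (\<Sum>b\<in>Basis. (h \<bullet> b) *\<^sub>R frechet_derivative F (at x) b)"
    if "x \<in> V" for x
  proof -
    interpret bounded_linear "frechet_derivative F (at x)"
      using Ck1_has_derivative[OF assms that] by (rule has_derivative_bounded_linear)
    have "frechet_derivative F (at x) h
        = frechet_derivative F (at x) (\<Sum>b\<in>Basis. (h \<bullet> b) *\<^sub>R b)"
      by (simp add: euclidean_representation)
    then show ?thesis
      by (simp add: sum scaleR)
  qed
  moreover have "continuous_on V (\<lambda>x. \<Sum>b\<in>Basis. (h \<bullet> b) *\<^sub>R frechet_derivative F (at x) b)"
    using assms unfolding Ck1_iff by (intro continuous_intros) auto
  ultimately show ?thesis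
    by (simp cong: continuous_on_cong)
qed

lemma Ck1_subset: "Ck_on 1 F V \<Longrightarrow> U \<subseteq> V \<Longrightarrow> Ck_on 1 F U"
  unfolding Ck1_iff using continuous_on_subset by blast

lemma Ck1_cong:
  assumes "Ck_on 1 F V" "open V" "\<And>x. x \<in> V \<Longrightarrow> F x = G x"
  shows "Ck_on 1 G V"
proof (rule Ck1I)
  show "(G has_derivative frechet_derivative F (at x)) (at x)" if "x \<in> V" for x
    using has_derivative_transform_within_open[OF Ck1_has_derivative[OF assms(1) that] assms(2) that]
      assms(3) by auto
qed (rule Ck1_continuous_partial[OF assms(1)])

lemma Ck1_Un:
  assumes "Ck_on 1 F U" "Ck_on 1 F V" "open U" "open V"
  shows "Ck_on 1 F (U \<union> V)"
  using assms unfolding Ck1_iff by (auto intro!: continuous_on_open_Un)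

text \<open>The chain rule is expanded in coordinates of the intermediate space. Continuity then
  concerns derivatives of \<open>G\<close> in fixed directions only, although the direction in which
  \<open>G\<close> is differentiated varies with the point.\<close>

lemma Ck1_compose:
  fixes F :: "'a::euclidean_space \<Rightarrow> 'b::euclidean_space"
    and G :: "'b \<Rightarrow> 'c::real_normed_vector"
  assumes F: "Ck_on 1 F V" and G: "Ck_on 1 G U" and im: "F ` V \<subseteq> U"
  shows "Ck_on 1 (\<lambda>x. G (F x)) V"
proof (rule Ck1I)
  fix x assume x: "x \<in> V"
  then have "F x \<in> U" using im by auto
  then show "((\<lambda>x. G (F x)) has_derivative
      (\<lambda>h. \<Sum>b\<in>Basis. (frechet_derivative F (at x) h \<bullet> b) *\<^sub>R frechet_derivative G (at (F x)) b)) (at x)"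
  proof -
    have G': "(G has_derivative frechet_derivative G (at (F x))) (at (F x))"
      by (rule Ck1_has_derivative[OF G \<open>F x \<in> U\<close>])
    then interpret bounded_linear "frechet_derivative G (at (F x))"
      by (rule has_derivative_bounded_linear)
    have eq: "frechet_derivative G (at (F x)) h
        = (\<Sum>b\<in>Basis. (h \<bullet> b) *\<^sub>R frechet_derivative G (at (F x)) b)" for h
    proof -
      have "frechet_derivative G (at (F x)) h
          = frechet_derivative G (at (F x)) (\<Sum>b\<in>Basis. (h \<bullet> b) *\<^sub>R b)"
        by (simp add: euclidean_representation)
      then show ?thesis
        by (simp add: sum scaleR)
    qed
    show ?thesis
      using has_derivative_compose[OF Ck1_has_derivative[OF F x] G'] by (simp add: eq[symmetric])
  qed
next
  fix b :: 'a assume "b \<in> Basis"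
  have "continuous_on V (\<lambda>x. frechet_derivative G (at (F x)) c)" for c
    using continuous_on_compose2[OF Ck1_continuous_partial[OF G] Ck1_continuous_on[OF F] im] .
  then show "continuous_on V (\<lambda>x. \<Sum>c\<in>Basis. (frechet_derivative F (at x) b \<bullet> c) *\<^sub>R
      frechet_derivative G (at (F x)) c)"
    by (intro continuous_intros Ck1_continuous_partial[OF F])
qed

lemma Ck1_const: "Ck_on 1 (\<lambda>x. c) V"
  by (rule Ck1I[where F' = "\<lambda>_ _. 0"]) auto

lemma Ck1_bounded_linear: "bounded_linear L \<Longrightarrow> Ck_on 1 L V"
  by (rule Ck1I[where F' = "\<lambda>_. L"]) (auto intro: bounded_linear_imp_has_derivative)

lemma Ck1_add:
  assumes F: "Ck_on 1 F V" and G: "Ck_on 1 G V"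
  shows "Ck_on 1 (\<lambda>x. F x + G x) V"
  by (rule Ck1I, rule has_derivative_add[OF Ck1_has_derivative[OF F] Ck1_has_derivative[OF G]], assumption+)
    (intro continuous_intros Ck1_continuous_partial[OF F] Ck1_continuous_partial[OF G])

lemma Ck1_diff:
  assumes F: "Ck_on 1 F V" and G: "Ck_on 1 G V"
  shows "Ck_on 1 (\<lambda>x. F x - G x) V"
  by (rule Ck1I, rule has_derivative_diff[OF Ck1_has_derivative[OF F] Ck1_has_derivative[OF G]], assumption+)
    (intro continuous_intros Ck1_continuous_partial[OF F] Ck1_continuous_partial[OF G])

lemma Ck1_scaleR:
  assumes f: "Ck_on 1 f V" and G: "Ck_on 1 G V"
  shows "Ck_on 1 (\<lambda>x. f x *\<^sub>R G x) V"
  by (rule Ck1I, rule has_derivative_scaleR[OF Ck1_has_derivative[OF f] Ck1_has_derivative[OF G]], assumption+)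
    (intro continuous_intros Ck1_continuous_partial[OF f] Ck1_continuous_partial[OF G]
      Ck1_continuous_on[OF f] Ck1_continuous_on[OF G])

lemma Ck1_mult:
  fixes f g :: "'a::euclidean_space \<Rightarrow> real"
  shows "Ck_on 1 f V \<Longrightarrow> Ck_on 1 g V \<Longrightarrow> Ck_on 1 (\<lambda>x. f x * g x) V"
  using Ck1_scaleR[of f V g] unfolding real_scaleR_def .

lemma Ck1_Pair:
  assumes F: "Ck_on 1 F V" and G: "Ck_on 1 G V"
  shows "Ck_on 1 (\<lambda>x. (F x, G x)) V"
  by (rule Ck1I, rule has_derivative_Pair[OF Ck1_has_derivative[OF F] Ck1_has_derivative[OF G]], assumption+)
    (intro continuous_intros Ck1_continuous_partial[OF F] Ck1_continuous_partial[OF G])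

lemma Ck1_sum:
  "finite I \<Longrightarrow> (\<And>i. i \<in> I \<Longrightarrow> Ck_on 1 (F i) V) \<Longrightarrow> Ck_on 1 (\<lambda>x. \<Sum>i\<in>I. F i x) V"
proof (induction I rule: finite_induct)
  case empty
  show ?case unfolding sum.empty by (rule Ck1_const)
next
  case (insert i I)
  show ?case
    unfolding sum.insert[OF insert.hyps] by (intro Ck1_add insert.IH insert.prems) auto
qed

text \<open>\<open>U\<close> and the complement of \<open>K\<close> form an open cover, and
  \<open>F\<close> vanishes on the latter. This makes products with cutoffs globally C^1 when some
  factors are controlled only on \<open>U\<close>.\<close>

lemma Ck1_zero_outside_compact:
  assumes "Ck_on 1 F U" "open U" "compact K" "K \<subseteq> U" "\<And>x. x \<notin> K \<Longrightarrow> F x = 0"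
  shows "Ck_on 1 F UNIV"
proof -
  have oK: "open (- K)"
    using assms(3) compact_imp_closed by blast
  have "Ck_on 1 F (- K)"
    using oK assms(5) by (intro Ck1_cong[OF Ck1_const[of 0]]) auto
  then have "Ck_on 1 F (U \<union> - K)"
    using assms oK by (intro Ck1_Un) auto
  moreover have "U \<union> - K = UNIV"
    using assms(4) by auto
  ultimately show ?thesis by simp
qed

section \<open>Divergence and its product rule\<close>

lemma divergence_eq:
  "(F has_derivative F') (at x) \<Longrightarrow> divergence F x = (\<Sum>b\<in>Basis. F' b \<bullet> b)"
  unfolding divergence_def using frechet_derivative_at by metis

lemma divergence_cong:
  assumes "open U" "x \<in> U" "\<And>y. y \<in> U \<Longrightarrow> F y = G y" "F differentiable (at x)"
  shows "divergence G x = divergence F x"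
proof -
  obtain F' where F': "(F has_derivative F') (at x)"
    using assms(4) by (auto simp: differentiable_def)
  then have "(G has_derivative F') (at x)"
    using has_derivative_transform_within_open[OF F' assms(1,2)] assms(3) by auto
  then show ?thesis
    using F' by (simp add: divergence_eq)
qed

lemma continuous_on_divergence:
  "Ck_on 1 F V \<Longrightarrow> continuous_on V (divergence F)"
  unfolding divergence_def[abs_def]
  by (intro continuous_intros) (rule Ck1_continuous_partial)

text \<open>This is the product rule. The last term pairs the gradient of \<theta> with
  \<open>Y x - \<psi> x\<close>; it is the only one that comes from the transition between the two
  fields.\<close>

lemma divergence_convex_combination:
  fixes \<psi> Y :: "'b::euclidean_space \<Rightarrow> 'b" and \<theta> :: "'b \<Rightarrow> real"
  assumes "(\<psi> has_derivative \<psi>') (at x)" "(Y has_derivative Y') (at x)"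
    and "(\<theta> has_derivative \<theta>') (at x)"
  shows "divergence (\<lambda>y. \<psi> y + \<theta> y *\<^sub>R (Y y - \<psi> y)) x
    = (1 - \<theta> x) * divergence \<psi> x + \<theta> x * divergence Y x + \<theta>' (Y x - \<psi> x)"
proof -
  interpret bounded_linear \<theta>'
    using assms(3) by (rule has_derivative_bounded_linear)
  have lin: "\<theta>' v = (\<Sum>b\<in>Basis. \<theta>' b * (v \<bullet> b))" for v
  proof -
    have "\<theta>' v = \<theta>' (\<Sum>b\<in>Basis. (v \<bullet> b) *\<^sub>R b)"
      by (simp add: euclidean_representation)
    then show ?thesis
      by (simp add: sum scaleR mult.commute)
  qed
  have "divergence (\<lambda>y. \<psi> y + \<theta> y *\<^sub>R (Y y - \<psi> y)) x
      = (\<Sum>b\<in>Basis. (\<psi>' b + (\<theta> x *\<^sub>R (Y' b - \<psi>' b) + \<theta>' b *\<^sub>R (Y x - \<psi> x))) \<bullet> b)"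
    by (intro divergence_eq derivative_intros assms)
  then show ?thesis
    unfolding divergence_eq[OF assms(1)] divergence_eq[OF assms(2)] lin[of "Y x - \<psi> x"]
    by (simp add: inner_add_left inner_diff_left sum.distrib sum_subtractf
        sum_distrib_left[symmetric] right_diff_distrib left_diff_distrib)
qed

section \<open>Cutoff functions and the normal field\<close>

lemma Ck1_real:
  fixes f :: "real \<Rightarrow> real"
  assumes "\<And>u. u \<in> V \<Longrightarrow> (f has_field_derivative f' u) (at u)" "continuous_on V f'"
  shows "Ck_on 1 f V"
  by (rule Ck1I[where F' = "\<lambda>u. (*) (f' u)"])
    (use assms in \<open>auto simp: has_field_derivative_def\<close>)

text \<open>Squaring removes the kink of the positive part. This is the building block of all
  cutoffs below; class C^1 is what \<open>test_fields\<close> asks for.\<close>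

lemma has_field_derivative_pos_part_power2:
  "((\<lambda>u::real. (max 0 u)\<^sup>2) has_field_derivative 2 * max 0 u) (at u)"
proof -
  consider "u > 0" | "u < 0" | "u = 0" by linarith
  then show ?thesis
  proof cases
    case 1
    have "((\<lambda>u. u\<^sup>2) has_field_derivative 2 * u) (at u)"
      by (auto intro!: derivative_eq_intros)
    then have "((\<lambda>u. (max 0 u)\<^sup>2) has_field_derivative 2 * u) (at u)"
      by (rule has_field_derivative_transform_within_open[where S = "{0<..}"]) (use 1 in auto)
    then show ?thesis using 1 by simp
  next
    case 2
    have "((\<lambda>u. 0) has_field_derivative 0) (at u)"
      by auto
    then have "((\<lambda>u. (max 0 u)\<^sup>2) has_field_derivative 0) (at u)"
      by (rule has_field_derivative_transform_within_open[where S = "{..<0}"]) (use 2 in auto)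
    then show ?thesis using 2 by simp
  next
    case 3
    \<comment> \<open>At the former kink the difference quotient is bounded by the absolute value of
      the increment.\<close>
    have "((\<lambda>h::real. (max 0 h)\<^sup>2 / h) \<longlongrightarrow> 0) (at 0)"
    proof (rule Lim_null_comparison)
      have "norm ((max 0 h)\<^sup>2 / h) \<le> \<bar>h\<bar>" for h :: real
        by (auto simp: max_def power2_eq_square)
      then show "\<forall>\<^sub>F h in at 0. norm ((max 0 h)\<^sup>2 / h) \<le> \<bar>h::real\<bar>"
        by simp
      show "((\<lambda>h::real. \<bar>h\<bar>) \<longlongrightarrow> 0) (at 0)"
        by (auto intro!: tendsto_eq_intros)
    qed
    then show ?thesis using 3 by (simp add: has_field_derivative_iff)
  qed
qed

text \<open>Twice the integral of the hat function with nodes \<open>0\<close>, \<open>1/2\<close>, \<open>1\<close> and height \<open>1\<close>.\<close>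

definition smoothstep :: "real \<Rightarrow> real" where
  "smoothstep u = 2 * (max 0 u)\<^sup>2 - 4 * (max 0 (u - 1/2))\<^sup>2 + 2 * (max 0 (u - 1))\<^sup>2"

definition smoothstep' :: "real \<Rightarrow> real" where
  "smoothstep' u = 4 * max 0 u - 8 * max 0 (u - 1/2) + 4 * max 0 (u - 1)"

lemma has_field_derivative_smoothstep:
  "(smoothstep has_field_derivative smoothstep' u) (at u)"
proof -
  have shift: "((\<lambda>u. (max 0 (u - a))\<^sup>2) has_field_derivative 2 * max 0 (u - a)) (at u)" for a :: real
    using DERIV_shift[of "\<lambda>u. (max 0 u)\<^sup>2" "2 * max 0 (u - a)" u "- a"]
      has_field_derivative_pos_part_power2[of "u - a"] by simp
  show ?thesis
    unfolding smoothstep_def[abs_def] smoothstep'_def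
    by (rule derivative_eq_intros shift has_field_derivative_pos_part_power2 refl)+ simp
qed

lemma smoothstep'_bounds: "0 \<le> smoothstep' u" "smoothstep' u \<le> 2"
  by (auto simp: smoothstep'_def max_def)

lemma smoothstep_eq_0: "u \<le> 0 \<Longrightarrow> smoothstep u = 0"
  by (simp add: smoothstep_def)

lemma smoothstep_eq_1: "1 \<le> u \<Longrightarrow> smoothstep u = 1"
  by (simp add: smoothstep_def power2_eq_square algebra_simps)

lemma smoothstep'_eq_0: "1 \<le> u \<Longrightarrow> smoothstep' u = 0"
  by (simp add: smoothstep'_def)

lemma smoothstep_mono: "u \<le> v \<Longrightarrow> smoothstep u \<le> smoothstep v"
  by (rule DERIV_nonneg_imp_nondecreasing) (use has_field_derivative_smoothstep smoothstep'_bounds in blast)+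

lemma smoothstep_bounds: "0 \<le> smoothstep u" "smoothstep u \<le> 1"
  \<comment> \<open>The values at \<open>min u 0\<close> and \<open>max u 1\<close> are known to be
    0 and 1.\<close>
  using smoothstep_mono[of "min u 0" u] smoothstep_mono[of u "max u 1"]
  by (simp_all add: smoothstep_eq_0 smoothstep_eq_1)

lemma Ck1_smoothstep: "Ck_on 1 smoothstep V"
  by (rule Ck1_real[OF has_field_derivative_smoothstep])
    (auto simp: smoothstep'_def[abs_def] intro!: continuous_intros)

text \<open>Using the squared norm avoids a singularity at the centre. The bump is not normalised:
  its height \<open>r ^ 4\<close> and its slope bound \<open>4 * r ^ 3\<close> enter the later
  constants.\<close>

definition bump :: "'a::euclidean_space \<Rightarrow> real \<Rightarrow> 'a \<Rightarrow> real" where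
  "bump x0 r x = (max 0 (r\<^sup>2 - (norm (x - x0))\<^sup>2))\<^sup>2"

definition bump_grad :: "'a::euclidean_space \<Rightarrow> real \<Rightarrow> 'a \<Rightarrow> 'a" where
  "bump_grad x0 r x = (- 4 * max 0 (r\<^sup>2 - (norm (x - x0))\<^sup>2)) *\<^sub>R (x - x0)"

lemma has_derivative_norm_diff_power2:
  fixes x0 :: "'a::euclidean_space"
  shows "((\<lambda>x. (norm (x - x0))\<^sup>2) has_derivative (\<lambda>h. 2 * ((x - x0) \<bullet> h))) (at x)"
  unfolding power2_norm_eq_inner
  by (auto intro!: derivative_eq_intros simp: inner_commute)

lemma Ck1_norm_diff_power2: "Ck_on 1 (\<lambda>x. (norm (x - x0))\<^sup>2) V"
  by (rule Ck1I[OF has_derivative_norm_diff_power2]) (intro continuous_intros)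

lemma has_derivative_bump:
  "(bump x0 r has_derivative (\<lambda>h. bump_grad x0 r x \<bullet> h)) (at x)"
proof -
  have "((\<lambda>x. r\<^sup>2 - (norm (x - x0))\<^sup>2) has_derivative (\<lambda>h. - (2 * ((x - x0) \<bullet> h)))) (at x)"
    using has_derivative_diff[OF has_derivative_const has_derivative_norm_diff_power2, of "r\<^sup>2" x0 x]
    by simp
  from has_derivative_compose[OF this
      has_field_derivative_pos_part_power2[unfolded has_field_derivative_def]]
  show ?thesis
    by (simp add: bump_def[abs_def] bump_grad_def mult_ac)
qed

lemma Ck1_bump: "Ck_on 1 (bump x0 r) V"
  by (rule Ck1I[OF has_derivative_bump]) (unfold bump_grad_def, intro continuous_intros)

lemma bump_nonneg: "0 \<le> bump x0 r x"
  by (simp add: bump_def)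

lemma bump_le: "bump x0 r x \<le> r ^ 4"
proof -
  have "(max 0 (r\<^sup>2 - (norm (x - x0))\<^sup>2))\<^sup>2 \<le> (r\<^sup>2)\<^sup>2"
    by (rule power_mono) auto
  then show ?thesis
    by (simp add: bump_def flip: power_mult)
qed

lemma bump_pos_iff: "0 < r \<Longrightarrow> 0 < bump x0 r x \<longleftrightarrow> x \<in> ball x0 r"
  using power_mono_iff[of r "norm (x - x0)" 2]
  by (auto simp: bump_def max_def dist_norm norm_minus_commute)

lemma norm_bump_grad_le: 
  assumes "0 < r"
  shows "norm (bump_grad x0 r x) \<le> 4 * r ^ 3"
proof (cases "norm (x - x0) \<le> r")
  case True
  then have "(norm (x - x0))\<^sup>2 \<le> r\<^sup>2"
    by (simp add: power_mono)
  then have "max 0 (r\<^sup>2 - (norm (x - x0))\<^sup>2) \<le> r\<^sup>2"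
    by simp
  then have "max 0 (r\<^sup>2 - (norm (x - x0))\<^sup>2) * norm (x - x0) \<le> r\<^sup>2 * r"
    using True by (intro mult_mono) auto
  then show ?thesis
    by (simp add: bump_grad_def power2_eq_square power3_eq_cube)
next
  case False
  then have "r\<^sup>2 \<le> (norm (x - x0))\<^sup>2"
    using assms by (intro power_mono) auto
  then show ?thesis
    using assms by (simp add: bump_grad_def)
qed

text \<open>As a function of the slope alone, it yields the vertically constant normal field of a
  graph by composition with the gradient.\<close>

definition upward_normal :: "'a::euclidean_space \<Rightarrow> 'a \<times> real" where
  "upward_normal v = (1 / sqrt (1 + (norm v)\<^sup>2)) *\<^sub>R (- v, 1)"

lemma Ck1_inverse_sqrt_norm: "Ck_on 1 (\<lambda>v::'a::euclidean_space. 1 / sqrt (1 + (norm v)\<^sup>2)) V"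
proof (rule Ck1_compose[where U = "{0<..}" and G = "\<lambda>u. 1 / sqrt u"])
  show "Ck_on 1 (\<lambda>v::'a. 1 + (norm v)\<^sup>2) V"
    using Ck1_add[OF Ck1_const Ck1_norm_diff_power2[of 0]] by (simp only: diff_zero)
  show "Ck_on 1 (\<lambda>u. 1 / sqrt u) {0<..}"
  proof (rule Ck1_real)
    show "((\<lambda>u. 1 / sqrt u) has_field_derivative - (inverse (sqrt u) / 2) / (sqrt u * sqrt u)) (at u)"
      if "u \<in> {0<..}" for u
      using that by (auto intro!: derivative_eq_intros)
    show "continuous_on {0<..} (\<lambda>u. - (inverse (sqrt u) / 2) / (sqrt u * sqrt u))"
      by (intro continuous_intros) auto
  qed
  show "(\<lambda>v. 1 + (norm v)\<^sup>2) ` V \<subseteq> {0<..}"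
    by (auto intro: add_pos_nonneg)
qed

lemma norm_graph_conormal: "norm (- v, 1::real) = sqrt (1 + (norm v)\<^sup>2)"
  by (simp add: norm_Pair)

lemma norm_upward_normal: "norm (upward_normal v) = 1"
proof -
  have "sqrt (1 + (norm v)\<^sup>2) > 0"
    by (simp add: add_pos_nonneg)
  then show ?thesis
    unfolding upward_normal_def norm_scaleR norm_graph_conormal by simp
qed

text \<open>The defect of calibration of a graph of slope \<open>w\<close> by the normal of slope \<open>v\<close> is
  quadratic in the difference of the slopes.\<close>

lemma upward_normal_inner_ge:
  "upward_normal v \<bullet> (- w, 1) \<ge> sqrt (1 + (norm w)\<^sup>2) - (norm (v - w))\<^sup>2 / 2"
proof -
  define a b where "a = sqrt (1 + (norm v)\<^sup>2)" and "b = sqrt (1 + (norm w)\<^sup>2)"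
  have a: "a \<ge> 1" "a\<^sup>2 = 1 + (norm v)\<^sup>2" and b: "b\<^sup>2 = 1 + (norm w)\<^sup>2"
    by (auto simp: a_def b_def)
  \<comment> \<open>Since \<open>a\<^sup>2 + b\<^sup>2\<close> is 2 plus the squared norms of
    \<open>v\<close> and \<open>w\<close>, this inequality bounds the defect
    \<open>a * b - (v \<bullet> w + 1)\<close> by half the squared distance of the slopes. Dividing
    by \<open>a \<ge> 1\<close> keeps that bound.\<close>
  have "2 * (a * b) \<le> a\<^sup>2 + b\<^sup>2"
    using sum_squares_bound[of a b] by simp
  moreover have "(norm (v - w))\<^sup>2 = (norm v)\<^sup>2 + (norm w)\<^sup>2 - 2 * (v \<bullet> w)"
    by (simp add: power2_norm_eq_inner inner_diff_left inner_diff_right inner_commute)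
  ultimately have "a * b - (v \<bullet> w + 1) \<le> (norm (v - w))\<^sup>2 / 2"
    using a b by simp
  also have "\<dots> \<le> a * ((norm (v - w))\<^sup>2 / 2)"
    using a(1) mult_right_mono[of 1 a "(norm (v - w))\<^sup>2 / 2"] by simp
  finally have "a * (b - (norm (v - w))\<^sup>2 / 2) \<le> v \<bullet> w + 1"
    by (simp add: right_diff_distrib)
  then have "b - (norm (v - w))\<^sup>2 / 2 \<le> (v \<bullet> w + 1) / a"
    using a(1) by (simp add: pos_le_divide_eq mult.commute)
  then show ?thesis
    by (simp add: upward_normal_def a_def[symmetric] b_def[symmetric] add_divide_distrib)
qed

section \<open>Subgraphs and their measure\<close>

lemma convex_combination_norm_le:
  fixes a b :: "'b::real_normed_vector"
  assumes "norm a \<le> 1" "norm b \<le> 1" "0 \<le> \<theta>" "\<theta> \<le> 1"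
  shows "norm (a + \<theta> *\<^sub>R (b - a)) \<le> 1"
proof -
  have "a + \<theta> *\<^sub>R (b - a) = (1 - \<theta>) *\<^sub>R a + \<theta> *\<^sub>R b"
    by (simp add: algebra_simps)
  moreover have "(1 - \<theta>) *\<^sub>R a + \<theta> *\<^sub>R b \<in> cball 0 1"
    by (rule convexD[OF convex_cball]) (use assms in auto)
  ultimately show ?thesis
    by simp
qed

lemma test_fieldsI:
  assumes "Ck_on 1 \<psi> UNIV" "compact K" "K \<subseteq> C" "\<And>x. x \<notin> K \<Longrightarrow> \<psi> x = 0"
  shows "\<psi> \<in> test_fields C"
proof -
  have "{x. \<psi> x \<noteq> 0} \<subseteq> K"
    using assms(4) by auto
  then have "closure {x. \<psi> x \<noteq> 0} \<subseteq> K"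
    using assms(2) by (simp add: closure_minimal compact_imp_closed)
  then show ?thesis
    using assms compact_Int_closed[of K "closure {x. \<psi> x \<noteq> 0}"]
    unfolding test_fields_def by (auto simp: Int_absorb1)
qed

lemma subgraph_eq: "subgraph \<omega> \<phi> = {z. fst z \<in> \<omega> \<and> 0 < snd z \<and> snd z < \<phi> (fst z)}"
  by (auto simp: subgraph_def)

lemma open_below_graph:
  fixes f :: "'a::euclidean_space \<Rightarrow> real"
  assumes "open \<omega>" "continuous_on \<omega> f"
  shows "open {z. fst z \<in> \<omega> \<and> snd z < f (fst z)}"
proof -
  have "continuous_on (\<omega> \<times> UNIV) (\<lambda>z. f (fst z))"
    by (rule continuous_on_compose2[OF assms(2)]) (auto intro!: continuous_intros)
  then have "continuous_on (\<omega> \<times> UNIV) (\<lambda>z. f (fst z) - snd z)"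
    by (intro continuous_intros)
  then have "open (\<omega> \<times> UNIV \<inter> (\<lambda>z. f (fst z) - snd z) -` {0<..})"
    using assms(1) by (intro continuous_open_preimage open_Times) auto
  also have "\<omega> \<times> UNIV \<inter> (\<lambda>z. f (fst z) - snd z) -` {0<..} = {z. fst z \<in> \<omega> \<and> snd z < f (fst z)}"
    by auto
  finally show ?thesis .
qed


lemma open_subgraph:
  fixes f :: "'a::euclidean_space \<Rightarrow> real"
  assumes "open \<omega>" "continuous_on \<omega> f"
  shows "open (subgraph \<omega> f)"
proof -
  have "subgraph \<omega> f = {z. fst z \<in> \<omega> \<and> snd z < f (fst z)} \<inter> {z. 0 < snd z}"
    by (auto simp: subgraph_eq)
  moreover have "open {z :: 'a \<times> real. 0 < snd z}"
    by (intro open_Collect_less continuous_intros)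
  ultimately show ?thesis
    using open_below_graph[OF assms] by auto
qed

lemma bounded_subgraph:
  fixes f :: "'a::euclidean_space \<Rightarrow> real"
  assumes "bounded \<omega>" "\<And>x. x \<in> \<omega> \<Longrightarrow> f x \<le> M"
  shows "bounded (subgraph \<omega> f)"
proof (rule bounded_subset)
  show "bounded (\<omega> \<times> {0..M})"
    using assms by (intro bounded_Times) auto
  show "subgraph \<omega> f \<subseteq> \<omega> \<times> {0..M}"
    using assms(2) by (force simp: subgraph_eq)
qed

text \<open>Tonelli: each vertical section over \<open>U\<close> is a half-open interval of length
  \<open>a\<close>. The half-open strip is a difference of two open regions below graphs, hence
  Borel.\<close>

lemma strip_measurable_emeasure:
  fixes f :: "'a::euclidean_space \<Rightarrow> real"
  assumes "open U" "continuous_on U f" "0 \<le> a"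
  shows "{z. fst z \<in> U \<and> f (fst z) \<le> snd z \<and> snd z < f (fst z) + a} \<in> sets borel"
    and "emeasure lborel {z. fst z \<in> U \<and> f (fst z) \<le> snd z \<and> snd z < f (fst z) + a}
      = ennreal a * emeasure lborel U"
proof -
  let ?S = "{z. fst z \<in> U \<and> f (fst z) \<le> snd z \<and> snd z < f (fst z) + a}"
  have "?S = {z. fst z \<in> U \<and> snd z < f (fst z) + a} - {z. fst z \<in> U \<and> snd z < f (fst z)}"
    by auto
  then show S: "?S \<in> sets borel"
    using open_below_graph[OF assms(1), of f] open_below_graph[OF assms(1), of "\<lambda>x. f x + a"] assms(2)
    by (simp add: continuous_on_add)
  have "emeasure lborel ?S = emeasure (lborel \<Otimes>\<^sub>M lborel) ?S"
    by (simp add: lborel_prod)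
  also have "\<dots> = (\<integral>\<^sup>+x. emeasure lborel (Pair x -` ?S) \<partial>lborel)"
    using S by (intro lborel.emeasure_pair_measure_alt) (simp only: lborel_prod sets_lborel)
  also have "\<dots> = (\<integral>\<^sup>+x. ennreal a * indicator U x \<partial>lborel)"
  proof (rule nn_integral_cong)
    fix x
    have "Pair x -` ?S = (if x \<in> U then {f x..<f x + a} else {})"
      by auto
    then show "emeasure lborel (Pair x -` ?S) = ennreal a * indicator U x"
      using assms(3) by (simp add: indicator_def)
  qed
  also have "\<dots> = ennreal a * emeasure lborel U"
    using assms(1) by (intro nn_integral_cmult_indicator) simp
  finally show "emeasure lborel ?S = ennreal a * emeasure lborel U" .
qed

lemma constant_width_strip:
  fixes f :: "'a::euclidean_space \<Rightarrow> real"
  assumes "open U" "continuous_on U f" "0 \<le> a" "U \<in> lmeasurable"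
  defines "S \<equiv> {z. fst z \<in> U \<and> f (fst z) \<le> snd z \<and> snd z < f (fst z) + a}"
  shows "S \<in> lmeasurable" "measure lebesgue S = a * measure lebesgue U"
proof -
  note strip = strip_measurable_emeasure[OF assms(1-3), folded S_def]
  have U: "emeasure lborel U = ennreal (measure lebesgue U)"
    using assms(1,4) emeasure_eq_measure2[of U lebesgue] by simp
  have S: "emeasure lebesgue S = ennreal (a * measure lebesgue U)"
    using strip assms(3) by (simp add: U ennreal_mult)
  then show "S \<in> lmeasurable"
    using strip(1) by (intro fmeasurableI) auto
  show "measure lebesgue S = a * measure lebesgue U"
    using S assms(3) by (simp add: measure_def)
qed

lemma continuous_on_bounded_abs_le:
  fixes f :: "'b::euclidean_space \<Rightarrow> real"
  assumes "continuous_on UNIV f" "bounded E"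
  obtains B where "0 \<le> B" "\<And>x. x \<in> E \<Longrightarrow> \<bar>f x\<bar> \<le> B"
proof -
  have "compact (f ` closure E)"
    using assms by (intro compact_continuous_image) (auto intro: continuous_on_subset)
  then have "bounded (f ` closure E)"
    by (rule compact_imp_bounded)
  then obtain B where "0 < B" "\<forall>y\<in>f ` closure E. norm y \<le> B"
    unfolding bounded_pos by (elim exE conjE)
  then show ?thesis
    using that[of B] closure_subset[of E] by auto
qed

text \<open>A bounded measurable set has finite measure, and a continuous function is bounded on its
  compact closure.\<close>

lemma bounded_set_integrable:
  fixes f :: "'b::euclidean_space \<Rightarrow> real"
  assumes "continuous_on UNIV f" "E \<in> sets lebesgue" "bounded E"
  shows "set_integrable lebesgue E f"
proof -
  have fm: "emeasure lebesgue E < \<infinity>"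
    by (metis assms(2,3) bounded_set_imp_lmeasurable fmeasurableD2 top.not_eq_extremum infinity_ennreal_def)
  obtain B where B: "\<And>x. x \<in> E \<Longrightarrow> \<bar>f x\<bar> \<le> B"
    using continuous_on_bounded_abs_le[OF assms(1,3)] by metis
  have "f \<in> borel_measurable lebesgue"
    using assms(1) by (intro measurable_completion) (simp add: borel_measurable_continuous_onI)
  then show ?thesis
    unfolding set_integrable_def
    by (intro integrableI_bounded_set_indicator[where B = B])
      (use assms fm B in auto)
qed

section \<open>Lowering the graph\<close>

text \<open>The field does not depend on the height, so its vertical component contributes nothing;
  the horizontal component is minus the normalised \<open>G\<close>.\<close>

lemma divergence_upward_normal_field:
  fixes G :: "'a::euclidean_space \<Rightarrow> 'a"
  assumes "Ck_on 1 G \<omega>" "x \<in> \<omega>"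
  shows "divergence (\<lambda>z. upward_normal (G (fst z))) (x, s)
    = - divergence (\<lambda>y. (1 / sqrt (1 + (norm (G y))\<^sup>2)) *\<^sub>R G y) x"
proof -
  let ?q = "\<lambda>y. 1 / sqrt (1 + (norm (G y))\<^sup>2)"
  have q: "Ck_on 1 ?q \<omega>"
    using Ck1_compose[OF assms(1) Ck1_inverse_sqrt_norm subset_UNIV] .
  obtain q' T' where q': "(?q has_derivative q') (at x)"
    and T': "((\<lambda>y. ?q y *\<^sub>R G y) has_derivative T') (at x)"
    using Ck1_has_derivative[OF q assms(2)] Ck1_has_derivative[OF Ck1_scaleR[OF q assms(1)] assms(2)]
    by blast
  have fst': "(fst has_derivative fst) (at (x, s))"
    by (rule bounded_linear_imp_has_derivative[OF bounded_linear_fst])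
  have "((\<lambda>z. (- (?q (fst z) *\<^sub>R G (fst z)), ?q (fst z))) has_derivative
      (\<lambda>h. (- T' (fst h), q' (fst h)))) (at (x, s))"
    using q' T' by (intro has_derivative_Pair has_derivative_minus has_derivative_compose[OF fst']) simp_all
  then have "((\<lambda>z. upward_normal (G (fst z))) has_derivative
      (\<lambda>h. (- T' (fst h), q' (fst h)))) (at (x, s))"
    by (simp add: upward_normal_def)
  then have "divergence (\<lambda>z. upward_normal (G (fst z))) (x, s)
      = (\<Sum>b\<in>Basis. (- T' (fst b), q' (fst b)) \<bullet> b)"
    by (rule divergence_eq)
  \<comment> \<open>The vertical basis vector \<open>(0, 1)\<close> has first component 0, hence the
    summand \<open>q' 0\<close>.\<close>
  also have "\<dots> = q' 0 + (\<Sum>b\<in>(\<lambda>u. (u, 0)) ` Basis. (- T' (fst b), q' (fst b)) \<bullet> b)"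
    unfolding Basis_prod_def by (subst sum.union_disjoint) auto
  also have "\<dots> = q' 0 - (\<Sum>b\<in>Basis. T' b \<bullet> b)"
    by (subst sum.reindex) (auto simp: inj_on_def sum_negf)
  also have "q' 0 = 0"
    using q' has_derivative_bounded_linear linear_simps(3) by blast
  finally show ?thesis
    by (simp add: divergence_eq[OF T'])
qed

text \<open>\<open>H\<close> is a lower bound near \<open>x0\<close> for the unnormalised curvature,
  that is \<open>DIM('a)\<close> times the mean curvature. The factor in \<open>2 * c\<close> leaves
  room to lower the graph by \<open>c\<close>; the radius \<open>2 * r\<close> leaves room for a
  lateral cutoff that is 1 on \<open>ball x0 r\<close>.\<close>

locale bent_graph =
  fixes \<omega> :: "'a::euclidean_space set" and \<phi> :: "'a \<Rightarrow> real"
    and x0 :: 'a and r c M H :: real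
  assumes open_base: "open \<omega>"
    and Ck1_phi: "Ck_on 1 \<phi> \<omega>" and Ck1_grad: "Ck_on 1 (grad \<phi>) \<omega>"
    and phi_lower: "\<And>x. x \<in> \<omega> \<Longrightarrow> 2 * c \<le> \<phi> x" and phi_upper: "\<And>x. x \<in> \<omega> \<Longrightarrow> \<phi> x < M"
    and c_pos: "0 < c" and r_pos: "0 < r" and cball_subset: "cball x0 (2 * r) \<subseteq> \<omega>"
    and H_nonneg: "0 \<le> H"
    and curvature: "\<And>x. x \<in> ball x0 r \<Longrightarrow>
      H \<le> - divergence (\<lambda>y. (1 / sqrt (1 + (norm (grad \<phi> y))\<^sup>2)) *\<^sub>R grad \<phi> y) x"
begin

definition bent :: "real \<Rightarrow> 'a \<Rightarrow> real" where
  "bent t x = \<phi> x - t * bump x0 r x"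

text \<open>The layer in which a given field is turned into the normal. It can rise above the graph
  of \<phi> where the bump is small, so it is later intersected with the removed region.\<close>

definition strip :: "real \<Rightarrow> real \<Rightarrow> ('a \<times> real) set" where
  "strip t \<epsilon> = {z. fst z \<in> ball x0 r \<and> bent t (fst z) \<le> snd z \<and> snd z < bent t (fst z) + \<epsilon>}"

lemma Ck1_bent: "Ck_on 1 (bent t) \<omega>"
  unfolding bent_def[abs_def] by (intro Ck1_diff Ck1_phi Ck1_mult Ck1_const Ck1_bump)

lemma bent_le: "0 \<le> t \<Longrightarrow> bent t x \<le> \<phi> x"
  by (simp add: bent_def bump_nonneg)

lemma bent_ge:
  assumes "0 \<le> t" "t * r ^ 4 \<le> c" "x \<in> \<omega>"
  shows "c \<le> bent t x"
  using mult_left_mono[OF bump_le assms(1), of x0 r x] assms(2) phi_lower[OF assms(3)]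
  by (simp add: bent_def)

lemma ball_subset: "ball x0 r \<subseteq> \<omega>"
  using cball_subset r_pos by force

lemma has_derivative_bent:
  assumes "x \<in> \<omega>"
  shows "(bent t has_derivative (\<lambda>h. (grad \<phi> x - t *\<^sub>R bump_grad x0 r x) \<bullet> h)) (at x)"
proof -
  have "(\<phi> has_derivative (\<lambda>h. grad \<phi> x \<bullet> h)) (at x)"
    using GDERIV_grad[of \<phi> x] Ck1_phi assms by (simp add: gderiv_def inner_commute)
  then show ?thesis
    unfolding bent_def[abs_def]
    by (auto intro!: derivative_eq_intros has_derivative_bump simp: inner_diff_left)
qed

lemma open_subgraph_bent: "open (subgraph \<omega> (bent t))"
  by (rule open_subgraph[OF open_base Ck1_continuous_on[OF Ck1_bent]])

lemma subgraph_bent_subset: "0 \<le> t \<Longrightarrow> subgraph \<omega> (bent t) \<subseteq> subgraph \<omega> \<phi>"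
  using bent_le by (auto simp: subgraph_eq intro: less_le_trans)

lemma difference_in_ball:
  assumes "z \<in> subgraph \<omega> \<phi> - subgraph \<omega> (bent t)"
  shows "fst z \<in> ball x0 r"
proof (rule ccontr)
  assume "fst z \<notin> ball x0 r"
  then have "bump x0 r (fst z) = 0"
    using bump_pos_iff[OF r_pos, of x0 "fst z"] bump_nonneg[of x0 r "fst z"] by linarith
  then show False
    using assms by (auto simp: subgraph_eq bent_def)
qed

text \<open>The cutoff \<theta> rises from 0 on the lowered graph to 1 at height \<epsilon> above
  it, and \<kappa> only localises. In the layer the gradient of \<theta> is at most
  \<open>2 / \<epsilon>\<close> times the conormal of the lowered graph, and the calibration defect
  is at most \<open>8 * r ^ 6 * t\<^sup>2\<close>; their product is the constant in the last bound.
  \<open>B\<close> pays for what remains of the divergence of \<psi>.\<close>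

lemma competitor_field:
  assumes t: "0 \<le> t" "t * r ^ 4 \<le> c" and \<epsilon>: "0 < \<epsilon>"
    and \<psi>: "\<psi> \<in> test_fields (cylinder \<omega>)" "\<And>x. norm (\<psi> x) \<le> 1"
    and B: "\<And>z. z \<in> subgraph \<omega> \<phi> \<Longrightarrow> \<bar>divergence \<psi> z\<bar> \<le> B"
  obtains \<psi>' where "\<psi>' \<in> test_fields (cylinder \<omega>)" "\<And>x. norm (\<psi>' x) \<le> 1"
    and "\<And>z. z \<in> subgraph \<omega> (bent t) \<Longrightarrow> divergence \<psi>' z = divergence \<psi> z"
    and "\<And>z. z \<in> subgraph \<omega> \<phi> - subgraph \<omega> (bent t) \<Longrightarrow>
      H - (H + B + 16 * r ^ 6 * t\<^sup>2 / \<epsilon>) * indicator (strip t \<epsilon>) z \<le> divergence \<psi>' z"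
proof -
  define \<theta> where "\<theta> z = smoothstep ((snd z - bent t (fst z)) * inverse \<epsilon>)" for z
  \<comment> \<open>The first factor is 1 on \<open>ball x0 r\<close> and 0 beyond radius
    \<open>2 * r\<close>; the second is 1 up to height \<open>M\<close> and 0 above
    \<open>M + 1\<close>.\<close>
  define \<kappa> where "\<kappa> z = smoothstep (2 - (norm (fst z - x0))\<^sup>2 * inverse (r\<^sup>2)) * smoothstep (M + 1 - snd z)"
    for z :: "'a \<times> real"
  define Y where "Y z = upward_normal (grad \<phi> (fst z))" for z :: "'a \<times> real"
  define \<psi>' where "\<psi>' z = \<psi> z + (\<kappa> z * \<theta> z) *\<^sub>R (Y z - \<psi> z)" for z
  let ?U = "\<omega> \<times> (UNIV :: real set)"
  \<comment> \<open>A compact part of the cylinder that carries the whole correction: over this ball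
    \<theta> vanishes below height \<open>c\<close>, which the lowered graph never undercuts, and
    \<kappa> handles the other sides.\<close>
  let ?K = "cball x0 (2 * r) \<times> {c..M + 1}"
  have oU: "open ?U"
    using open_base by (intro open_Times) auto
  have fst: "Ck_on 1 fst ?U" and snd: "Ck_on 1 snd ?U"
    by (rule Ck1_bounded_linear[OF bounded_linear_fst], rule Ck1_bounded_linear[OF bounded_linear_snd])
  have Ck1_fst: "Ck_on 1 (\<lambda>z. g (fst z)) ?U" if "Ck_on 1 g \<omega>" for g :: "'a \<Rightarrow> 'c::real_normed_vector"
    by (rule Ck1_compose[OF fst that]) auto
  have Ck1_step: "Ck_on 1 (\<lambda>z. smoothstep (g z)) ?U" if "Ck_on 1 g ?U" for g
    by (rule Ck1_compose[OF that Ck1_smoothstep subset_UNIV])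
  have C\<theta>: "Ck_on 1 \<theta> ?U"
    unfolding \<theta>_def[abs_def]
    by (intro Ck1_step Ck1_mult Ck1_diff Ck1_const snd Ck1_fst Ck1_bent)
  have C\<kappa>: "Ck_on 1 \<kappa> ?U"
    unfolding \<kappa>_def[abs_def]
    by (intro Ck1_step Ck1_mult Ck1_diff Ck1_const snd Ck1_fst[OF Ck1_norm_diff_power2])
  have "Ck_on 1 (\<lambda>x. upward_normal (grad \<phi> x)) \<omega>"
    unfolding upward_normal_def
    by (intro Ck1_scaleR Ck1_Pair Ck1_const Ck1_compose[OF Ck1_grad Ck1_inverse_sqrt_norm subset_UNIV]
        Ck1_compose[OF Ck1_grad Ck1_bounded_linear subset_UNIV] bounded_linear_minus bounded_linear_ident)
  then have CY: "Ck_on 1 Y ?U"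
    unfolding Y_def[abs_def] by (rule Ck1_fst)
  have C\<psi>: "Ck_on 1 \<psi> V" for V
    using \<psi>(1) by (intro Ck1_subset[of _ UNIV V]) (auto simp: test_fields_def)
  have \<theta>_bounds: "0 \<le> \<theta> z" "\<theta> z \<le> 1" and \<kappa>_bounds: "0 \<le> \<kappa> z" "\<kappa> z \<le> 1" for z
    by (simp_all add: \<theta>_def \<kappa>_def smoothstep_bounds mult_le_one)
  have zero: "(\<kappa> z * \<theta> z) *\<^sub>R (Y z - \<psi> z) = 0" if "z \<notin> ?K" for z
  proof -
    obtain x s where z: "z = (x, s)" by (cases z)
    consider "x \<notin> cball x0 (2 * r)" | "x \<in> cball x0 (2 * r)" "s < c" | "M + 1 < s"
      using \<open>z \<notin> ?K\<close> unfolding z by fastforce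
    then have "\<kappa> z * \<theta> z = 0"
    proof cases
      case 1
      then have "(2 * r)\<^sup>2 \<le> (norm (x - x0))\<^sup>2"
        using r_pos by (intro power_mono) (auto simp: dist_norm norm_minus_commute)
      then have "2 * r\<^sup>2 \<le> (norm (x - x0))\<^sup>2"
        using zero_le_power2[of r] unfolding power_mult_distrib power2_eq_square[of 2] by linarith
      then have "2 \<le> (norm (x - x0))\<^sup>2 * inverse (r\<^sup>2)"
        using r_pos by (simp add: field_simps)
      then show ?thesis
        by (simp add: \<kappa>_def z smoothstep_eq_0)
    next
      case 2
      then have "x \<in> \<omega>"
        using cball_subset by auto
      then have "(s - bent t x) * inverse \<epsilon> \<le> 0"
        using bent_ge[OF t, of x] 2 \<epsilon> by (intro mult_nonpos_nonneg) auto
      then show ?thesis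
        by (simp add: \<theta>_def z smoothstep_eq_0)
    next
      case 3
      then show ?thesis
        by (simp add: \<kappa>_def z smoothstep_eq_0)
    qed
    then show ?thesis by simp
  qed
  have compactK: "compact ?K"
    by (intro compact_Times) auto
  \<comment> \<open>\<open>bent t\<close> and \<open>Y\<close> are regular only over \<omega>; the
    product extends by zero.\<close>
  have "Ck_on 1 (\<lambda>z. (\<kappa> z * \<theta> z) *\<^sub>R (Y z - \<psi> z)) UNIV"
    by (rule Ck1_zero_outside_compact[OF _ oU compactK _ zero])
      (use cball_subset in \<open>auto intro!: Ck1_scaleR Ck1_mult Ck1_diff C\<kappa> C\<theta> CY C\<psi> simp del: Ck_on.simps One_nat_def\<close>)
  then have C\<psi>': "Ck_on 1 \<psi>' UNIV"
    unfolding \<psi>'_def[abs_def] by (intro Ck1_add C\<psi>)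
  have 1: "\<psi>' \<in> test_fields (cylinder \<omega>)"
  proof (rule test_fieldsI[OF C\<psi>', of "closure {z. \<psi> z \<noteq> 0} \<union> ?K"])
    show "compact (closure {z. \<psi> z \<noteq> 0} \<union> ?K)"
      using \<psi>(1) compactK by (intro compact_Un) (auto simp: test_fields_def)
    show "closure {z. \<psi> z \<noteq> 0} \<union> ?K \<subseteq> cylinder \<omega>"
      using \<psi>(1) cball_subset c_pos by (auto simp: test_fields_def cylinder_def)
    show "\<psi>' z = 0" if "z \<notin> closure {z. \<psi> z \<noteq> 0} \<union> ?K" for z
    proof -
      have "\<psi> z = 0"
        using that closure_subset[of "{z. \<psi> z \<noteq> 0}"] by auto
      then show ?thesis
        using zero[of z] that unfolding \<psi>'_def by auto
    qed
  qed
  have 2: "norm (\<psi>' z) \<le> 1" for z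
    unfolding \<psi>'_def
    using \<psi>(2) \<theta>_bounds \<kappa>_bounds
    by (intro convex_combination_norm_le) (auto simp: Y_def norm_upward_normal mult_le_one)
  have 3: "divergence \<psi>' z = divergence \<psi> z" if "z \<in> subgraph \<omega> (bent t)" for z
  proof (rule divergence_cong[OF open_subgraph_bent that])
    show "\<psi> differentiable at z"
      using C\<psi>[of UNIV] unfolding Ck1_iff by blast
    show "\<psi> y = \<psi>' y" if "y \<in> subgraph \<omega> (bent t)" for y
    proof -
      have "(snd y - bent t (fst y)) * inverse \<epsilon> \<le> 0"
        using that \<epsilon> by (intro mult_nonpos_nonneg) (auto simp: subgraph_eq)
      then show ?thesis
        by (simp add: \<psi>'_def \<theta>_def smoothstep_eq_0)
    qed
  qed
  have 4: "H - (H + B + 16 * r ^ 6 * t\<^sup>2 / \<epsilon>) * indicator (strip t \<epsilon>) z \<le> divergence \<psi>' z"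
    if z: "z \<in> subgraph \<omega> \<phi> - subgraph \<omega> (bent t)" for z
  proof -
    obtain x s where xs: "z = (x, s)" by (cases z)
    have x: "x \<in> \<omega>" "x \<in> ball x0 r" and s: "bent t x \<le> s" "s < M"
      using z difference_in_ball[OF z] phi_upper[of x] by (auto simp: xs subgraph_eq)
    \<comment> \<open>The slope of the lowered graph; the gradient of \<theta> will be
      \<open>k\<close> times the conormal \<open>(- w, 1)\<close>.\<close>
    define w where "w = grad \<phi> x - t *\<^sub>R bump_grad x0 r x"
    define k where "k = smoothstep' ((s - bent t x) * inverse \<epsilon>) / \<epsilon>"
    have k: "0 \<le> k" "k \<le> 2 / \<epsilon>"
      using smoothstep'_bounds \<epsilon> by (auto simp: k_def intro: divide_right_mono)
    have "((\<lambda>z. (snd z - bent t (fst z)) * inverse \<epsilon>) has_derivative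
        (\<lambda>h. (snd h - w \<bullet> fst h) * inverse \<epsilon>)) (at z)"
      unfolding w_def
      by (intro has_derivative_mult_left has_derivative_diff has_derivative_compose[of fst fst, where g = "bent t"]
          bounded_linear_imp_has_derivative[OF bounded_linear_fst] bounded_linear_imp_has_derivative[OF bounded_linear_snd])
        (use has_derivative_bent[OF x(1)] in \<open>simp add: xs\<close>)
    from has_derivative_compose[OF this
        has_field_derivative_smoothstep[unfolded has_field_derivative_def]]
    have \<theta>': "(\<theta> has_derivative (\<lambda>h. k * ((- w, 1) \<bullet> h))) (at z)"
      by (simp add: \<theta>_def[abs_def] k_def xs inner_prod_def divide_inverse algebra_simps)
    have \<psi>d: "(\<psi> has_derivative frechet_derivative \<psi> (at z)) (at z)"
      by (rule Ck1_has_derivative[OF C\<psi>[of UNIV]]) simp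
    have Yd: "(Y has_derivative frechet_derivative Y (at z)) (at z)"
      by (rule Ck1_has_derivative[OF CY]) (use x xs in auto)
    \<comment> \<open>On this open neighbourhood of \<open>z\<close> the cutoff \<kappa> is
      identically 1 and drops out of the derivative.\<close>
    let ?W = "ball x0 r \<times> {..<M}"
    have "divergence \<psi>' z = divergence (\<lambda>y. \<psi> y + \<theta> y *\<^sub>R (Y y - \<psi> y)) z"
    proof (rule divergence_cong)
      show "open ?W" "z \<in> ?W"
        using x s by (auto simp: xs intro: open_Times)
      show "\<psi> y + \<theta> y *\<^sub>R (Y y - \<psi> y) = \<psi>' y" if "y \<in> ?W" for y
      proof -
        have "(norm (fst y - x0))\<^sup>2 \<le> r\<^sup>2"
          using that by (intro power_mono) (auto simp: dist_norm norm_minus_commute)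
        then have "(norm (fst y - x0))\<^sup>2 * inverse (r\<^sup>2) \<le> 1"
          using r_pos by (simp add: field_simps)
        then have "\<kappa> y = 1"
          using that by (auto simp: \<kappa>_def smoothstep_eq_1)
        then show ?thesis
          by (simp add: \<psi>'_def)
      qed
      show "(\<lambda>y. \<psi> y + \<theta> y *\<^sub>R (Y y - \<psi> y)) differentiable (at z)"
        using has_derivative_add[OF \<psi>d has_derivative_scaleR[OF \<theta>' has_derivative_diff[OF Yd \<psi>d]]]
        by (auto simp: differentiable_def)
    qed
    also have "\<dots> = (1 - \<theta> z) * divergence \<psi> z + \<theta> z * divergence Y z + k * ((- w, 1) \<bullet> (Y z - \<psi> z))"
      by (rule divergence_convex_combination[OF \<psi>d Yd \<theta>'])
    finally have div: "divergence \<psi>' z = \<dots>" .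
    have divY: "H \<le> divergence Y z"
      using curvature[OF x(2)] divergence_upward_normal_field[OF Ck1_grad x(1), of s]
      by (simp add: Y_def[abs_def] xs)
    \<comment> \<open>Above the layer \<theta> is 1 with zero derivative, which leaves the
      divergence of \<open>Y\<close>. Inside it, the claimed bound reduces to \<open>- B\<close>
      minus the defect term.\<close>
    show ?thesis
    proof (cases "s < bent t x + \<epsilon>")
      case False
      then have "1 \<le> (s - bent t x) * inverse \<epsilon>"
        using \<epsilon> by (simp add: field_simps)
      then have "\<theta> z = 1" "k = 0"
        by (simp_all add: \<theta>_def k_def xs smoothstep_eq_1 smoothstep'_eq_0)
      then show ?thesis
        using False div divY by (simp add: strip_def xs)
    next
      case True
      then have ind: "indicator (strip t \<epsilon>) z = (1::real)"
        using x s by (simp add: strip_def xs)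
      have "(1 - \<theta> z) * divergence \<psi> z \<ge> - B"
      proof -
        have "\<bar>(1 - \<theta> z) * divergence \<psi> z\<bar> \<le> 1 * B"
          unfolding abs_mult using B[of z] z \<theta>_bounds[of z] by (intro mult_mono) auto
        then show ?thesis by linarith
      qed
      moreover have "\<theta> z * divergence Y z \<ge> 0"
        using divY H_nonneg \<theta>_bounds(1)[of z] by simp
      moreover have "k * ((- w, 1) \<bullet> (Y z - \<psi> z)) \<ge> - (16 * r ^ 6 * t\<^sup>2 / \<epsilon>)"
      proof -
        let ?g = "sqrt (1 + (norm w)\<^sup>2)"
        \<comment> \<open>By Cauchy-Schwarz \<psi> cannot exceed the length of the conormal, while
          \<open>Y\<close> attains it up to a term quadratic in the change of slope
          \<open>t *\<^sub>R bump_grad x0 r x\<close>.\<close>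
        have "(- w, 1) \<bullet> \<psi> z \<le> ?g"
          using norm_cauchy_schwarz[of "(- w, 1)" "\<psi> z"] \<psi>(2)[of z]
            mult_left_mono[of "norm (\<psi> z)" 1 ?g] unfolding norm_graph_conormal by simp
        moreover have "(- w, 1) \<bullet> Y z \<ge> ?g - (norm (t *\<^sub>R bump_grad x0 r x))\<^sup>2 / 2"
          using upward_normal_inner_ge[where v = "grad \<phi> x" and w = w]
          by (simp add: Y_def xs inner_commute w_def)
        moreover have "(norm (t *\<^sub>R bump_grad x0 r x))\<^sup>2 \<le> (t * (4 * r ^ 3))\<^sup>2"
          using norm_bump_grad_le[OF r_pos] t by (intro power_mono) (auto intro: mult_left_mono)
        moreover have "(t * (4 * r ^ 3))\<^sup>2 = 16 * r ^ 6 * t\<^sup>2"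
          by (simp add: power_mult_distrib flip: power_mult)
        ultimately have "(- w, 1) \<bullet> (Y z - \<psi> z) \<ge> - (8 * r ^ 6 * t\<^sup>2)"
          unfolding inner_diff_right by linarith
        then have "k * ((- w, 1) \<bullet> (Y z - \<psi> z)) \<ge> k * - (8 * r ^ 6 * t\<^sup>2)"
          using k(1) by (rule mult_left_mono)
        moreover have "k * (8 * r ^ 6 * t\<^sup>2) \<le> (2 / \<epsilon>) * (8 * r ^ 6 * t\<^sup>2)"
          using k(2) r_pos by (intro mult_right_mono) auto
        ultimately show ?thesis by simp
      qed
      ultimately show ?thesis
        unfolding div ind mult_1_right by linarith
    qed
  qed
  show ?thesis
    using that[OF 1 2 3 4] .
qed

end

section \<open>Volume and perimeter of the lowered subgraph\<close>

lemma vol_lmeasurable: "A \<in> lmeasurable \<Longrightarrow> vol A = ereal (measure lebesgue A)"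
  by (simp add: vol_def emeasure_eq_measure2)

lemma measure_open_pos:
  assumes "open A" "A \<noteq> {}" "A \<in> lmeasurable"
  shows "0 < measure lebesgue A"
  using open_not_negligible[OF assms(1,2)] assms(3) negligible_iff_measure[of A]
  by (auto simp: zero_less_measure_iff)

context bent_graph
begin

lemma bounded_subgraph_phi: "bounded \<omega> \<Longrightarrow> bounded (subgraph \<omega> \<phi>)"
  by (rule bounded_subgraph) (use phi_upper in \<open>auto intro: less_imp_le\<close>)

lemma lmeasurable_subgraphs:
  assumes "bounded \<omega>" "0 \<le> t"
  shows "subgraph \<omega> \<phi> \<in> lmeasurable" "subgraph \<omega> (bent t) \<in> lmeasurable"
    "subgraph \<omega> \<phi> - subgraph \<omega> (bent t) \<in> lmeasurable"
proof -
  have "bounded (subgraph \<omega> (bent t))"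
    using bounded_subset[OF bounded_subgraph_phi[OF assms(1)] subgraph_bent_subset[OF assms(2)]] .
  then show 1: "subgraph \<omega> \<phi> \<in> lmeasurable" "subgraph \<omega> (bent t) \<in> lmeasurable"
    using bounded_subgraph_phi[OF assms(1)] open_subgraph_bent
      open_subgraph[OF open_base Ck1_continuous_on[OF Ck1_phi]] by (auto intro: lmeasurable_open)
  then show "subgraph \<omega> \<phi> - subgraph \<omega> (bent t) \<in> lmeasurable"
    by (rule fmeasurable.Diff)
qed

lemma lmeasurable_strip:
  assumes "0 \<le> \<epsilon>"
  shows "strip t \<epsilon> \<in> lmeasurable" "measure lebesgue (strip t \<epsilon>) = \<epsilon> * measure lebesgue (ball x0 r)"
proof -
  have "continuous_on (ball x0 r) (bent t)"
    using Ck1_continuous_on[OF Ck1_bent] ball_subset continuous_on_subset by blast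
  from constant_width_strip[OF open_ball this assms lmeasurable_ball]
  show "strip t \<epsilon> \<in> lmeasurable" "measure lebesgue (strip t \<epsilon>) = \<epsilon> * measure lebesgue (ball x0 r)"
    by (simp_all add: strip_def)
qed

text \<open>The width \<open>\<epsilon>\<close> of the layer tends to \<open>0\<close> with \<open>t\<close> fixed, so that the bound on \<open>divergence \<psi>\<close> drops out.\<close>

lemma integral_divergence_bent_le:
  assumes \<omega>: "bounded \<omega>" and t: "0 \<le> t" "t * r ^ 4 \<le> c"
    and p: "rel_perimeter (cylinder \<omega>) (subgraph \<omega> \<phi>) = ereal p"
    and \<psi>: "\<psi> \<in> test_fields (cylinder \<omega>)" "\<And>x. norm (\<psi> x) \<le> 1"
  shows "(LINT z:subgraph \<omega> (bent t)|lebesgue. divergence \<psi> z)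
    \<le> p - H * measure lebesgue (subgraph \<omega> \<phi> - subgraph \<omega> (bent t))
      + 16 * r ^ 6 * t\<^sup>2 * measure lebesgue (ball x0 r)"
proof -
  let ?\<Omega> = "subgraph \<omega> \<phi>" and ?E = "subgraph \<omega> (bent t)" and ?\<beta> = "measure lebesgue (ball x0 r)"
  let ?D = "?\<Omega> - ?E"
  note lm = lmeasurable_subgraphs[OF \<omega> t(1)]
  have C1: "Ck_on 1 f UNIV" if "f \<in> test_fields (cylinder \<omega>)" for f
    using that by (simp add: test_fields_def)
  have bE: "bounded ?E" and bD: "bounded ?D"
    using bounded_subgraph_phi[OF \<omega>] subgraph_bent_subset[OF t(1)] by (auto intro: bounded_subset)
  obtain B where B: "0 \<le> B" "\<And>z. z \<in> ?\<Omega> \<Longrightarrow> \<bar>divergence \<psi> z\<bar> \<le> B"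
    using continuous_on_bounded_abs_le[OF continuous_on_divergence[OF C1[OF \<psi>(1)]] bounded_subgraph_phi[OF \<omega>]]
    by blast
  have key: "(LINT z:?E|lebesgue. divergence \<psi> z)
      \<le> p - H * measure lebesgue ?D + 16 * r ^ 6 * t\<^sup>2 * ?\<beta> + (H + B) * ?\<beta> * \<epsilon>" if \<epsilon>: "0 < \<epsilon>" for \<epsilon>
  proof -
    let ?C = "H + B + 16 * r ^ 6 * t\<^sup>2 / \<epsilon>" and ?S = "strip t \<epsilon>"
    obtain \<psi>' where \<psi>': "\<psi>' \<in> test_fields (cylinder \<omega>)" "\<And>x. norm (\<psi>' x) \<le> 1"
      and eq: "\<And>z. z \<in> ?E \<Longrightarrow> divergence \<psi>' z = divergence \<psi> z"
      and ge: "\<And>z. z \<in> ?D \<Longrightarrow> H - ?C * indicator ?S z \<le> divergence \<psi>' z"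
      using competitor_field[OF t \<epsilon> \<psi> B(2)] by metis
    have int: "set_integrable lebesgue A (divergence \<psi>')" if "A \<in> lmeasurable" "bounded A" for A
      using bounded_set_integrable[OF continuous_on_divergence[OF C1[OF \<psi>'(1)]]] that by auto
    have S: "?S \<in> lmeasurable" "measure lebesgue ?S = \<epsilon> * ?\<beta>"
      using lmeasurable_strip \<epsilon> by auto
    have C: "0 \<le> ?C"
      using H_nonneg B(1) \<epsilon> r_pos by simp
    have pt: "indicator ?D z *\<^sub>R (?C * indicator ?S z) = ?C * indicator (?D \<inter> ?S) z" for z
      by (simp add: indicator_def)
    have const: "set_integrable lebesgue ?D (\<lambda>z. H)"
      using lm(3) by (intro bounded_set_integrable bD) auto
    have "integrable lebesgue (\<lambda>z. ?C * indicator (?D \<inter> ?S) z)"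
      using fmeasurable.Int[OF lm(3) S(1)]
      by (intro integrable_mult_right integrable_real_indicator) (simp_all add: fmeasurable_def del: emeasure_completion)
    then have ind: "set_integrable lebesgue ?D (\<lambda>z. ?C * indicator ?S z)"
      unfolding set_integrable_def pt .
    have "(LINT z:?D|lebesgue. ?C * indicator ?S z) = ?C * measure lebesgue (?D \<inter> ?S)"
      unfolding set_lebesgue_integral_def pt integral_mult_right_zero integral_indicator by simp
    also have "\<dots> \<le> ?C * (\<epsilon> * ?\<beta>)"
      using C S lm(3) measure_mono_fmeasurable[of "?D \<inter> ?S" ?S lebesgue]
      by (intro mult_left_mono) auto
    \<comment> \<open>The volume of the layer cancels the \<open>1 / \<epsilon>\<close> of the
      defect; only the part with \<open>H + B\<close> keeps a factor \<epsilon>.\<close>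
    also have "\<dots> = (H + B) * ?\<beta> * \<epsilon> + 16 * r ^ 6 * t\<^sup>2 * ?\<beta>"
      using \<epsilon> by (simp add: algebra_simps)
    finally have S_le: "(LINT z:?D|lebesgue. ?C * indicator ?S z)
        \<le> (H + B) * ?\<beta> * \<epsilon> + 16 * r ^ 6 * t\<^sup>2 * ?\<beta>" .
    have "(LINT z:?D|lebesgue. H) = H * measure lebesgue ?D"
      using lm(3) by (subst set_integral_const) (auto simp: fmeasurableD2 simp del: emeasure_completion)
    with S_le have "H * measure lebesgue ?D - ((H + B) * ?\<beta> * \<epsilon> + 16 * r ^ 6 * t\<^sup>2 * ?\<beta>)
        \<le> (LINT z:?D|lebesgue. H) - (LINT z:?D|lebesgue. ?C * indicator ?S z)"
      by linarith
    also have "\<dots> = (LINT z:?D|lebesgue. H - ?C * indicator ?S z)"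
      using set_integral_diff(2)[OF const ind] by simp
    also have "\<dots> \<le> (LINT z:?D|lebesgue. divergence \<psi>' z)"
      using set_integral_diff(1)[OF const ind] int[OF lm(3) bD] ge by (rule set_integral_mono)
    finally have D: "H * measure lebesgue ?D - ((H + B) * ?\<beta> * \<epsilon> + 16 * r ^ 6 * t\<^sup>2 * ?\<beta>)
        \<le> (LINT z:?D|lebesgue. divergence \<psi>' z)" .
    have "(LINT z:?E|lebesgue. divergence \<psi>' z) = (LINT z:?E|lebesgue. divergence \<psi> z)"
      using lm(2) eq by (intro set_lebesgue_integral_cong) auto
    moreover have "(LINT z:?\<Omega>|lebesgue. divergence \<psi>' z)
        = (LINT z:?E|lebesgue. divergence \<psi>' z) + (LINT z:?D|lebesgue. divergence \<psi>' z)"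
      using set_integral_Un[OF _ int[OF lm(2) bE] int[OF lm(3) bD]] subgraph_bent_subset[OF t(1)]
      by (simp add: Un_absorb1 Int_Diff)
    \<comment> \<open>The modified field competes in the perimeter of the full subgraph; its share
      over the removed region is then subtracted.\<close>
    moreover have "(LINT z:?\<Omega>|lebesgue. divergence \<psi>' z) \<le> p"
    proof -
      have "ereal (LINT z:?\<Omega>|lebesgue. divergence \<psi>' z) \<le> ereal p"
        unfolding p[symmetric] rel_perimeter_def using \<psi>' by (intro SUP_upper) auto
      then show ?thesis by simp
    qed
    ultimately show ?thesis
      using D by linarith
  qed
  show ?thesis
  proof (rule field_le_epsilon)
    fix e :: real assume "0 < e"
    let ?K = "(H + B) * ?\<beta>"
    have K: "0 \<le> ?K"
      using H_nonneg B(1) by simp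
    \<comment> \<open>This width makes the remaining error at most \<open>e\<close>; adding 1 keeps
      the denominator positive when \<open>?K\<close> is 0.\<close>
    have "?K * (e / (?K + 1)) \<le> e"
      using K \<open>0 < e\<close> by (simp add: divide_le_eq field_simps)
    then show "(LINT z:?E|lebesgue. divergence \<psi> z)
        \<le> p - H * measure lebesgue ?D + 16 * r ^ 6 * t\<^sup>2 * ?\<beta> + e"
      using key[of "e / (?K + 1)"] K \<open>0 < e\<close> by simp
  qed
qed

text \<open>The preceding bound no longer involves \<psi>, so it passes to the supremum over all
  admissible fields.\<close>

lemma rel_perimeter_bent_le:
  assumes "bounded \<omega>" "0 \<le> t" "t * r ^ 4 \<le> c"
    and "rel_perimeter (cylinder \<omega>) (subgraph \<omega> \<phi>) = ereal p"
  shows "rel_perimeter (cylinder \<omega>) (subgraph \<omega> (bent t))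
    \<le> ereal (p - H * measure lebesgue (subgraph \<omega> \<phi> - subgraph \<omega> (bent t))
      + 16 * r ^ 6 * t\<^sup>2 * measure lebesgue (ball x0 r))"
  unfolding rel_perimeter_def
  by (rule SUP_least, unfold ereal_less_eq(3), rule integral_divergence_bent_le[OF assms]) blast+

text \<open>On the ball of half the radius the bump is at least \<open>9 / 16 * r ^ 4\<close>, hence
  at least \<open>r ^ 4 / 2\<close>. The removed region thus contains a strip of constant width just
  under the original graph, and its volume grows at least linearly in \<open>t\<close>.\<close>

lemma measure_difference_ge:
  assumes "bounded \<omega>" "0 \<le> t" "t * r ^ 4 \<le> c"
  shows "t * (r ^ 4 / 2 * measure lebesgue (ball x0 (r / 2)))
    \<le> measure lebesgue (subgraph \<omega> \<phi> - subgraph \<omega> (bent t))"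
proof -
  let ?h = "t * (r ^ 4 / 2)" and ?U = "ball x0 (r / 2)"
  let ?S = "{z. fst z \<in> ?U \<and> \<phi> (fst z) - ?h \<le> snd z \<and> snd z < \<phi> (fst z) - ?h + ?h}"
  have U: "?U \<subseteq> \<omega>"
    using ball_subset r_pos subset_ball[of "r / 2" r x0] by simp
  have "continuous_on ?U (\<lambda>x. \<phi> x - ?h)"
    using Ck1_continuous_on[OF Ck1_phi] U by (intro continuous_intros) (rule continuous_on_subset)
  then have S: "?S \<in> lmeasurable" "measure lebesgue ?S = ?h * measure lebesgue ?U"
    using constant_width_strip[of ?U "\<lambda>x. \<phi> x - ?h" ?h] assms(2) by (simp_all add: lmeasurable_ball)
  have "?S \<subseteq> subgraph \<omega> \<phi> - subgraph \<omega> (bent t)"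
  proof
    fix z assume z: "z \<in> ?S"
    then have x: "fst z \<in> \<omega>" using U by auto
    have "(norm (fst z - x0))\<^sup>2 \<le> (r / 2)\<^sup>2"
      using z by (intro power_mono) (auto simp: dist_norm norm_minus_commute)
    then have "3 / 4 * r\<^sup>2 \<le> r\<^sup>2 - (norm (fst z - x0))\<^sup>2"
      by (simp add: power_divide)
    then have "3 / 4 * r\<^sup>2 \<le> max 0 (r\<^sup>2 - (norm (fst z - x0))\<^sup>2)"
      unfolding le_max_iff_disj by blast
    then have "(3 / 4 * r\<^sup>2)\<^sup>2 \<le> bump x0 r (fst z)"
      unfolding bump_def by (intro power_mono) auto
    moreover have "(3 / 4 * r\<^sup>2)\<^sup>2 = 9 / 16 * r ^ 4"
      by (simp add: power_mult_distrib power_divide flip: power_mult)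
    moreover have "0 \<le> r ^ 4"
      by simp
    ultimately have "r ^ 4 / 2 \<le> bump x0 r (fst z)"
      by linarith
    then have "bent t (fst z) \<le> \<phi> (fst z) - ?h"
      using assms(2) by (simp add: bent_def mult_left_mono del: times_divide_eq_right)
    then show "z \<in> subgraph \<omega> \<phi> - subgraph \<omega> (bent t)"
      using z x bent_ge[OF assms(2,3) x] c_pos by (auto simp: subgraph_eq)
  qed
  then have "measure lebesgue ?S \<le> measure lebesgue (subgraph \<omega> \<phi> - subgraph \<omega> (bent t))"
    using S(1) lmeasurable_subgraphs(3)[OF assms(1,2)] by (intro measure_mono_fmeasurable) auto
  then show ?thesis
    using S(2) by simp
qed

text \<open>If \<open>H\<close> exceeded the quotient by \<open>d > 0\<close>, lowering the graph
  would gain at least \<open>d * q * t\<close> against an error of at most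
  \<open>K * t\<^sup>2\<close>, contradicting minimality for small \<open>t\<close>.\<close>

lemma curvature_le_cheeger_quotient:
  assumes \<omega>: "bounded \<omega>" and sc: "self_cheeger (cylinder \<omega>) (subgraph \<omega> \<phi>)"
    and p: "rel_perimeter (cylinder \<omega>) (subgraph \<omega> \<phi>) = ereal p"
  shows "H \<le> p / measure lebesgue (subgraph \<omega> \<phi>)"
proof (rule ccontr)
  define v where "v = measure lebesgue (subgraph \<omega> \<phi>)"
  define d where "d = H - p / v"
  define q where "q = r ^ 4 / 2 * measure lebesgue (ball x0 (r / 2))"
  define K where "K = 16 * r ^ 6 * measure lebesgue (ball x0 r)"
  assume "\<not> H \<le> p / measure lebesgue (subgraph \<omega> \<phi>)"
  then have d: "0 < d"
    by (simp add: d_def v_def)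
  have q: "0 < q"
    using r_pos by (simp add: q_def measure_open_pos lmeasurable_ball)
  have K: "0 \<le> K"
    by (simp add: K_def)
  have x0: "x0 \<in> \<omega>"
    using ball_subset r_pos by auto
  have ineq: "d * q \<le> K * t" if t: "0 < t" "t * r ^ 4 \<le> c" for t
  proof -
    let ?D = "subgraph \<omega> \<phi> - subgraph \<omega> (bent t)" and ?E = "subgraph \<omega> (bent t)"
    have t0: "0 \<le> t" using t by simp
    note lm = lmeasurable_subgraphs[OF \<omega> t0]
    \<comment> \<open>A point of the open set \<open>?E\<close>, whose volume is therefore positive,
      as a competitor in the Cheeger constant requires.\<close>
    have "(x0, c / 2) \<in> ?E"
      using x0 bent_ge[OF t0 t(2) x0] c_pos by (simp add: subgraph_eq)
    then have E: "0 < measure lebesgue ?E"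
      using measure_open_pos[OF open_subgraph_bent _ lm(2)] by blast
    have D: "measure lebesgue ?D = v - measure lebesgue ?E"
      unfolding v_def using lm subgraph_bent_subset[OF t0] by (intro measurable_measure_Diff) auto
    have v: "0 < v"
      using E D measure_nonneg[of lebesgue ?D] by linarith
    have "ereal (p / v) = rel_cheeger_constant (cylinder \<omega>) (subgraph \<omega> \<phi>)"
      using sc v lm(1) by (simp add: self_cheeger_def p vol_lmeasurable v_def)
    also have "\<dots> \<le> rel_perimeter (cylinder \<omega>) ?E / vol ?E"
      unfolding rel_cheeger_constant_def
      using lm(2) E subgraph_bent_subset[OF t0] by (intro INF_lower) (auto simp: vol_lmeasurable)
    also have "\<dots> \<le> ereal (p - H * measure lebesgue ?D + K * t\<^sup>2) / vol ?E"
    proof (rule ereal_divide_right_mono)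
      have "16 * r ^ 6 * t\<^sup>2 * measure lebesgue (ball x0 r) = K * t\<^sup>2"
        unfolding K_def by (simp only: mult_ac)
      then show "rel_perimeter (cylinder \<omega>) ?E \<le> ereal (p - H * measure lebesgue ?D + K * t\<^sup>2)"
        using rel_perimeter_bent_le[OF \<omega> t0 t(2) p] by (simp only:)
      show "0 < vol ?E"
        using E lm(2) by (simp add: vol_lmeasurable)
    qed
    finally have "p / v * measure lebesgue ?E \<le> p - H * measure lebesgue ?D + K * t\<^sup>2"
      using E lm(2) by (simp add: vol_lmeasurable pos_le_divide_eq)
    \<comment> \<open>Substituting these cancels \<open>p\<close> on both sides and leaves the
      excess \<open>d\<close> times the removed volume.\<close>
    moreover have "measure lebesgue ?E = v - measure lebesgue ?D" "p / v * v = p"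
      using D v by auto
    ultimately have "d * measure lebesgue ?D \<le> K * t\<^sup>2"
      unfolding d_def by (simp add: left_diff_distrib right_diff_distrib)
    moreover have "d * (t * q) \<le> d * measure lebesgue ?D"
      using measure_difference_ge[OF \<omega> t0 t(2)] d by (intro mult_left_mono) (auto simp: q_def)
    ultimately have "t * (d * q) \<le> t * (K * t)"
      by (simp add: power2_eq_square mult_ac)
    then show ?thesis
      using t(1) by simp
  qed
  \<comment> \<open>The first bound keeps the lowering within \<open>c\<close>, the second forces
    \<open>K * t\<close> below \<open>d * q / 2\<close>; \<open>K + 1\<close> is positive even if
    \<open>K\<close> is 0.\<close>
  define t where "t = min (c / r ^ 4) (d * q / (2 * (K + 1)))"
  have "0 < t" "t * r ^ 4 \<le> c"
    using c_pos r_pos d q K by (auto simp: t_def min_def field_simps)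
  then have "d * q \<le> K * t"
    by (rule ineq)
  also have "\<dots> \<le> (K + 1) * (d * q / (2 * (K + 1)))"
    using K d q \<open>0 < t\<close> by (intro mult_mono) (auto simp: t_def)
  also have "\<dots> = d * q / 2"
    using K by (simp add: field_simps)
  finally show False
    using d q by (simp add: mult_le_0_iff field_simps) 
qed

end

section \<open>Interior regularity and the passage to the curvature bound\<close>

lemma Ck_on_cong:
  assumes "open U" "\<And>x. x \<in> U \<Longrightarrow> f x = g x"
  shows "Ck_on k f U \<Longrightarrow> Ck_on k g U"
  using assms(2)
proof (induction k arbitrary: f g)
  case 0
  then show ?case by (simp cong: continuous_on_cong)
next
  case (Suc k)
  \<comment> \<open>Since \<open>U\<close> is open, the two functions agree near \<open>x\<close>,
    so they share the derivative there.\<close>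
  have D: "(g has_derivative frechet_derivative f (at x)) (at x)" if "x \<in> U" for x
  proof (rule has_derivative_transform_within_open[OF _ assms(1) that])
    show "(f has_derivative frechet_derivative f (at x)) (at x)"
      using Suc.prems(1) that by (simp add: frechet_derivative_works)
  qed (rule Suc.prems(2))
  have "Ck_on k (\<lambda>x. frechet_derivative g (at x) b) U" if "b \<in> Basis" for b
  proof (rule Suc.IH)
    show "Ck_on k (\<lambda>x. frechet_derivative f (at x) b) U"
      using Suc.prems(1) that by simp
    show "frechet_derivative f (at x) b = frechet_derivative g (at x) b" if "x \<in> U" for x
      using frechet_derivative_at[OF D[OF that]] by simp
  qed
  moreover have "g differentiable at x" if "x \<in> U" for x
    using D[OF that] by (auto simp: differentiable_def)
  ultimately show ?case by simp
qed

text \<open>The extended derivatives provided by \<open>Ck_closure\<close> agree with the partial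
  derivatives on \<open>U\<close>, so the induction hypothesis for them is transferred by
  \<open>Ck_on_cong\<close>.\<close>

lemma Ck_closure_imp_Ck_on: "open U \<Longrightarrow> Ck_closure k f U \<Longrightarrow> Ck_on k f U"
proof (induction k arbitrary: f)
  case 0
  then show ?case
    using continuous_on_subset[OF _ closure_subset, of U f] by simp
next
  case (Suc k)
  have "Ck_on k (\<lambda>x. frechet_derivative f (at x) b) U" if "b \<in> Basis" for b
  proof -
    have "\<forall>b\<in>Basis. \<exists>g. Ck_closure k g U \<and> (\<forall>x\<in>U. g x = frechet_derivative f (at x) b)"
      using Suc.prems(2) by simp
    from bspec[OF this that] obtain g
      where g: "Ck_closure k g U" "\<forall>x\<in>U. g x = frechet_derivative f (at x) b"
      by (elim exE conjE)
    show ?thesis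
      by (rule Ck_on_cong[OF Suc.prems(1) _ Suc.IH[OF Suc.prems(1) g(1)]]) (use g(2) in simp)
  qed
  then show ?case
    using Suc.prems(2) by simp
qed

lemma Ck2_imp_Ck1_grad:
  assumes "Ck_on 2 f U"
  shows "Ck_on 1 f U" "Ck_on 1 (grad f) U"
proof -
  have Suc2: "(2::nat) = Suc 1" by simp
  have diff: "\<forall>x\<in>U. f differentiable at x"
    and partial: "\<And>b. b \<in> Basis \<Longrightarrow> Ck_on 1 (\<lambda>x. frechet_derivative f (at x) b) U"
    using assms unfolding Suc2 Ck_on.simps(2)[of 1] by blast+
  show "Ck_on 1 f U"
    unfolding Ck1_iff using diff Ck1_continuous_on[OF partial] by blast
  show "Ck_on 1 (grad f) U"
    unfolding grad_def[abs_def] by (intro Ck1_sum Ck1_scaleR Ck1_const partial) auto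
qed

lemma rel_perimeter_nonneg: "0 \<le> rel_perimeter C E"
proof -
  have "(\<lambda>x. 0) \<in> test_fields C"
    using Ck1_const[of 0 UNIV] by (simp add: test_fields_def)
  then have "ereal (LINT x:E|lebesgue. divergence (\<lambda>x. 0) x) \<le> rel_perimeter C E"
    unfolding rel_perimeter_def by (intro SUP_upper) auto
  moreover have "divergence (\<lambda>x::'a. 0::'a) = (\<lambda>x. 0)"
    by (rule ext) (simp add: divergence_eq[OF has_derivative_const])
  ultimately show ?thesis
    by (simp add: set_lebesgue_integral_def zero_ereal_def)
qed

theorem theorem3p7:
  fixes \<omega> :: "'a::euclidean_space set" and \<phi> :: "'a \<Rightarrow> real"
  assumes "smooth_bounded_domain \<omega>"
    and "Ck_closure 2 \<phi> \<omega>"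
    and "\<forall>x\<in>closure \<omega>. \<phi> x > 0"
    and "meets_orthogonally \<omega> \<phi>"
    and "self_cheeger (cylinder \<omega>) (subgraph \<omega> \<phi>)"
  shows "\<forall>p\<in>graph_over \<omega> \<phi>. ereal (graph_mean_curvature \<phi> (fst p))
           \<le> rel_perimeter (cylinder \<omega>) (subgraph \<omega> \<phi>)
               / (ereal (real DIM('a)) * vol (subgraph \<omega> \<phi>))"
proof
  fix P assume "P \<in> graph_over \<omega> \<phi>"
  then obtain x0 where x0: "x0 \<in> \<omega>" "fst P = x0"
    by (auto simp: graph_over_def)
  let ?\<Omega> = "subgraph \<omega> \<phi>" and ?C = "cylinder \<omega>" and ?N = "real DIM('a)"
  define v where "v = measure lebesgue ?\<Omega>"
  define T where "T y = (1 / sqrt (1 + (norm (grad \<phi> y))\<^sup>2)) *\<^sub>R grad \<phi> y" for y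
  have \<omega>: "open \<omega>" "bounded \<omega>"
    using assms(1) by (auto simp: smooth_bounded_domain_def)
  have "Ck_on 2 \<phi> \<omega>"
    using assms(2) by (rule Ck_closure_imp_Ck_on[OF \<omega>(1)])
  note C1 = Ck2_imp_Ck1_grad[OF this]
  have compact: "compact (closure \<omega>)" and ne: "closure \<omega> \<noteq> {}"
    using \<omega>(2) x0(1) closure_subset by auto
  have cont: "continuous_on (closure \<omega>) \<phi>"
    using assms(2) by (simp add: numeral_2_eq_2)
  obtain a b where a: "a \<in> closure \<omega>" "\<forall>x\<in>closure \<omega>. \<phi> a \<le> \<phi> x"
    and b: "\<forall>x\<in>closure \<omega>. \<phi> x \<le> \<phi> b"
    using continuous_attains_inf[OF compact ne cont] continuous_attains_sup[OF compact ne cont] by blast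
  \<comment> \<open>Halving the minimum gives \<open>2 * c \<le> \<phi> x\<close>; adding 1 to the
    maximum makes the upper bound strict.\<close>
  define c M where "c = \<phi> a / 2" and "M = \<phi> b + 1"
  have c: "0 < c" "2 * c \<le> \<phi> x" and M: "\<phi> x < M" if "x \<in> \<omega>" for x
  proof -
    have "x \<in> closure \<omega>" using that closure_subset by auto
    then show "0 < c" "2 * c \<le> \<phi> x" "\<phi> x < M"
      using a b assms(3) by (auto simp: c_def M_def intro: le_less_trans)
  qed
  have bent: "bent_graph \<omega> \<phi> x0 r c M H"
    if "0 < r" "cball x0 (2 * r) \<subseteq> \<omega>" "0 \<le> H" "\<And>x. x \<in> ball x0 r \<Longrightarrow> H \<le> - divergence T x" for r H
    using that \<omega> C1 c M x0(1) by unfold_locales (auto simp: T_def[abs_def] simp del: Ck_on.simps One_nat_def)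
  have open\<Omega>: "open ?\<Omega>"
    by (rule open_subgraph[OF \<omega>(1) Ck1_continuous_on[OF C1(1)]])
  have "bounded ?\<Omega>"
    using \<omega>(2) M by (intro bounded_subgraph[where M = M]) (auto intro: less_imp_le)
  then have lm: "?\<Omega> \<in> lmeasurable"
    using open\<Omega> by (rule lmeasurable_open)
  have "(x0, c) \<in> ?\<Omega>"
    using c[OF x0(1)] x0(1) by (simp add: subgraph_eq)
  then have v: "0 < v"
    unfolding v_def using open\<Omega> lm by (intro measure_open_pos) auto
  have vol: "vol ?\<Omega> = ereal v"
    unfolding v_def by (rule vol_lmeasurable[OF lm])
  have N: "0 < ?N" by simp
  show "ereal (graph_mean_curvature \<phi> (fst P)) \<le> rel_perimeter ?C ?\<Omega> / (ereal ?N * vol ?\<Omega>)"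
  proof (cases "rel_perimeter ?C ?\<Omega>")
    case PInf
    then show ?thesis using v N by (simp add: vol)
  next
    case MInf
    then show ?thesis using rel_perimeter_nonneg[of ?C ?\<Omega>] by simp
  next
    case (real p)
    then have p: "0 \<le> p"
      using rel_perimeter_nonneg[of ?C ?\<Omega>] by simp
    have "- divergence T x0 \<le> p / v"
    proof (rule ccontr)
      assume "\<not> - divergence T x0 \<le> p / v"
      \<comment> \<open>A value strictly in between persists as a lower bound on a whole ball by
        continuity, and it is nonnegative because \<open>p\<close> is.\<close>
      then obtain H where H: "p / v < H" "H < - divergence T x0"
        using dense not_le by blast
      have "Ck_on 1 T \<omega>"
        unfolding T_def[abs_def]
        by (rule Ck1_scaleR[OF Ck1_compose[OF C1(2) Ck1_inverse_sqrt_norm subset_UNIV] C1(2)])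
      then have "continuous_on \<omega> (\<lambda>x. - divergence T x)"
        by (intro continuous_intros continuous_on_divergence)
      then have "open (\<omega> \<inter> (\<lambda>x. - divergence T x) -` {H<..})"
        using \<omega>(1) by (intro continuous_open_preimage) auto
      moreover have "x0 \<in> \<omega> \<inter> (\<lambda>x. - divergence T x) -` {H<..}"
        using x0(1) H(2) by simp
      ultimately obtain \<rho> where \<rho>: "0 < \<rho>" "cball x0 \<rho> \<subseteq> \<omega> \<inter> (\<lambda>x. - divergence T x) -` {H<..}"
        unfolding open_contains_cball by blast
      \<comment> \<open>Half of \<rho> is taken because the locale needs the closed ball of twice
        its radius inside \<omega>.\<close>
      have "bent_graph \<omega> \<phi> x0 (\<rho> / 2) c M H"
      proof (rule bent)
        show "0 \<le> H"
          using H(1) p v by (meson divide_nonneg_pos less_imp_le order_trans)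
        show "H \<le> - divergence T x" if "x \<in> ball x0 (\<rho> / 2)" for x
        proof -
          have "x \<in> cball x0 \<rho>"
            using that \<rho>(1) by simp
          then show ?thesis using \<rho>(2) by auto
        qed
      qed (use \<rho> in auto)
      then have "H \<le> p / v"
        unfolding v_def by (rule bent_graph.curvature_le_cheeger_quotient[OF _ \<omega>(2) assms(5) real])
      then show False using H(1) by simp
    qed
    \<comment> \<open>Dividing by the dimension of the base turns the unnormalised curvature into
      the mean curvature.\<close>
    then have "graph_mean_curvature \<phi> x0 \<le> p / (?N * v)"
      using N v by (simp add: graph_mean_curvature_def T_def[abs_def] field_simps)
    then show ?thesis
      using N v by (simp add: x0(2) real vol)
  qed
qed

end
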